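(* The space complexity $f(n)$ of an arbitrary deterministic Turing machine $M$ is equivalent to the space function of some finitely presented semigroup (or monoid) $P$.
   Context: Words and presentations. For an alphabet $A$, $A^*$ is the set of all words in $A$, $A^+$ the set of non-empty words, $|w|$ the length of $w$. A semigroup (resp. monoid) presentation $\langle A\mid R\rangle$ has $R\subset A^+\times A^+$ (resp. $R\subset A^*\times A^*$); it is finite if $A$ and $R$ are finite. Space function. Let $P=\langle A\mid R\rangle$ be finitely presented. A derivation from $w$ to $w'$ (words in $A^+$, resp. $A^*$) is a sequence $w=w_0\to w_1\to\dots\to w_t=w'$, $t\ge 0$, where for each $i<t$ one has $w_i=ur'v$, $w_{i+1}=ur''v$ for some words $u,v$ and $(r',r'')\in R$ or $(r'',r')\in R$. Two words are equal in $P$ iff there is a derivation between them. The space of the derivation is $\max_{0\le i\le t}|w_i|$. For words $w,w'$ equal in $P$, $\mathrm{space}_P(w,w')$ is the minimum of the spaces of derivations from $w$ to $w'$. The space function of $P$ is $s(n)=\max \mathrm{space}_P(w,w')$ over all pairs of words $w,w'$ equal in $P$ with $|w|,|w'|\le n$. Equivalence. For nondecreasing functions $f,g$ on $\mathbb N$: $f\preceq g$ if there is a positive integer $c$ with $f(n)\le c\,g(cn)+cn$ for all $n\in\mathbb N$; $f$ and $g$ are equivalent, $f\sim g$, if $f\preceq g$ and $g\preceq f$. Turing machines. Machines are multi-tape with one head per tape; a configuration records the words to the left and right of each head and the states of the heads; tape squares may be inserted and deleted. An input configuration has the input word on the first tape, all other tapes empty, heads at the right ends, and the start states. A word is accepted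 if the machine reaches the accept states with all tapes empty, and rejected if the (deterministic) machine halts in non-accepting states with all tapes empty. Standing assumption: a deterministic Turing machine accepts or rejects every input word (it never runs forever on an input configuration). The space of a computation is the maximum, over its configurations, of the total number of tape letters (on all tapes, including the input tape); the space of an input word $u$ is the minimal space of a computation that accepts or rejects $u$; the space complexity of $M$ is the function $n\mapsto$ maximum of the space over all input words of length $\le n$. *)

theory Defs
  imports Complex_Main
begin

section \<open>Presentations and their space functions\<close>

definition semigroup_words :: "'b set \<Rightarrow> 'b list set" where
  "semigroup_words A = lists A - {[]}"

definition finite_semigroup_presentation ::
    "'b set \<Rightarrow> ('b list \<times> 'b list) set \<Rightarrow> bool" where
  "finite_semigroup_presentation A R \<longleftrightarrow>
     finite A \<and> finite R \<and> R \<subseteq> semigroup_words A \<times> semigroup_words A"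

definition finite_monoid_presentation ::
    "'b set \<Rightarrow> ('b list \<times> 'b list) set \<Rightarrow> bool" where
  "finite_monoid_presentation A R \<longleftrightarrow>
     finite A \<and> finite R \<and> R \<subseteq> lists A \<times> lists A"

definition rewrite_step :: "('b list \<times> 'b list) set \<Rightarrow> 'b list \<Rightarrow> 'b list \<Rightarrow> bool" where
  "rewrite_step R w w' \<longleftrightarrow>
     (\<exists>u v r r'. ((r, r') \<in> R \<or> (r', r) \<in> R) \<and> w = u @ r @ v \<and> w' = u @ r' @ v)"

text \<open>
  A derivation is the non-empty list of all its words. If \<open>R\<close> is a set of pairs of
  (non-empty) words over \<open>A\<close> and the first word is a (non-empty) word over \<open>A\<close>, then so are
  all the others; hence the alphabet is not a parameter, and the same notion serves
  semigroups and monoids.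
\<close>

definition derivation ::
    "('b list \<times> 'b list) set \<Rightarrow> 'b list \<Rightarrow> 'b list \<Rightarrow> 'b list list \<Rightarrow> bool" where
  "derivation R w w' ws \<longleftrightarrow>
     ws \<noteq> [] \<and> hd ws = w \<and> last ws = w' \<and> successively (rewrite_step R) ws"

definition derivation_space :: "'b list list \<Rightarrow> nat" where
  "derivation_space ws = Max (length ` set ws)"

definition equal_in :: "('b list \<times> 'b list) set \<Rightarrow> 'b list \<Rightarrow> 'b list \<Rightarrow> bool" where
  "equal_in R w w' \<longleftrightarrow> (\<exists>ws. derivation R w w' ws)"

definition pair_space :: "('b list \<times> 'b list) set \<Rightarrow> 'b list \<Rightarrow> 'b list \<Rightarrow> nat" where
  "pair_space R w w' = (LEAST s. \<exists>ws. derivation R w w' ws \<and> derivation_space ws = s)"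

text \<open>
  Over a finite alphabet the suprema below range over finite sets of natural numbers, so they
  are maxima, with the convention \<open>Sup {} = 0\<close> (no semigroup word has length \<open>0\<close>).
\<close>

definition semigroup_space_function ::
    "'b set \<Rightarrow> ('b list \<times> 'b list) set \<Rightarrow> nat \<Rightarrow> nat" where
  "semigroup_space_function A R n =
     Sup {pair_space R w w' | w w'. w \<in> semigroup_words A \<and> w' \<in> semigroup_words A \<and>
            length w \<le> n \<and> length w' \<le> n \<and> equal_in R w w'}"

definition monoid_space_function ::
    "'b set \<Rightarrow> ('b list \<times> 'b list) set \<Rightarrow> nat \<Rightarrow> nat" where
  "monoid_space_function A R n =
     Sup {pair_space R w w' | w w'. w \<in> lists A \<and> w' \<in> lists A \<and>
            length w \<le> n \<and> length w' \<le> n \<and> equal_in R w w'}"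


section \<open>Equivalence of functions\<close>

text \<open>
  The natural numbers start at \<open>1\<close> here. At \<open>n = 0\<close> the inequality would read
  \<open>f 0 \<le> c * g 0\<close>; space functions of semigroups and monoids vanish at \<open>0\<close>, whereas a machine
  may well use space on the empty input.
\<close>

definition fun_preceq :: "(nat \<Rightarrow> nat) \<Rightarrow> (nat \<Rightarrow> nat) \<Rightarrow> bool" where
  "fun_preceq f g \<longleftrightarrow> (\<exists>c>0. \<forall>n\<ge>1. f n \<le> c * g (c * n) + c * n)"

definition fun_equiv :: "(nat \<Rightarrow> nat) \<Rightarrow> (nat \<Rightarrow> nat) \<Rightarrow> bool" where
  "fun_equiv f g \<longleftrightarrow> fun_preceq f g \<and> fun_preceq g f"


section \<open>Turing machines\<close>

text \<open>
  A configuration of one tape is \<open>(u, q, v)\<close>: the word \<open>u\<close> to the left of the head, the state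
  \<open>q\<close> of the head, the word \<open>v\<close> to the right of the head, both words written from left to
  right. A tape consists of exactly the squares of \<open>u\<close> and \<open>v\<close>; there is no blank symbol.

  The part of a command that concerns one tape replaces a factor \<open>u q v\<close> around the head by
  \<open>u' q' v'\<close>, where the lengths may differ, so that squares can be inserted and deleted. If
  \<open>at_left\<close> (\<open>at_right\<close>) is set, it applies only if nothing is left of \<open>u\<close> (right of \<open>v\<close>);
  this is how a machine sees the end markers of a tape.
\<close>

type_synonym ('a, 'q) tape_config = "'a list \<times> 'q \<times> 'a list"

type_synonym ('a, 'q) config = "('a, 'q) tape_config list"

record ('a, 'q) command_part =
  at_left :: bool
  left_old :: "'a list"
  state_old :: 'q
  right_old :: "'a list"
  at_right :: bool
  left_new :: "'a list"
  state_new :: 'q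
  right_new :: "'a list"

type_synonym ('a, 'q) tm_command = "('a, 'q) command_part list"

text \<open>Tapes are numbered from \<open>0\<close>; tape \<open>0\<close> is the input tape.\<close>

record ('a, 'q) tm =
  num_tapes :: nat
  input_alphabet :: "'a set"
  tape_alphabet :: "nat \<Rightarrow> 'a set"
  head_states :: "nat \<Rightarrow> 'q set"
  tm_commands :: "('a, 'q) tm_command set"
  start_states :: "'q list"
  accept_states :: "'q list"

definition state_vector :: "('a, 'q) tm \<Rightarrow> 'q list \<Rightarrow> bool" where
  "state_vector M qs \<longleftrightarrow>
     length qs = num_tapes M \<and> (\<forall>i<num_tapes M. qs ! i \<in> head_states M i)"

definition wf_part :: "'a set \<Rightarrow> 'q set \<Rightarrow> ('a, 'q) command_part \<Rightarrow> bool" where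
  "wf_part Y Q p \<longleftrightarrow>
     left_old p \<in> lists Y \<and> right_old p \<in> lists Y \<and>
     left_new p \<in> lists Y \<and> right_new p \<in> lists Y \<and>
     state_old p \<in> Q \<and> state_new p \<in> Q"

definition turing_machine :: "('a, 'q) tm \<Rightarrow> bool" where
  "turing_machine M \<longleftrightarrow>
     num_tapes M \<ge> 1 \<and>
     input_alphabet M \<subseteq> tape_alphabet M 0 \<and>
     (\<forall>i<num_tapes M. finite (tape_alphabet M i) \<and> finite (head_states M i)) \<and>
     finite (tm_commands M) \<and>
     (\<forall>\<theta>\<in>tm_commands M. length \<theta> = num_tapes M \<and>
        (\<forall>i<num_tapes M. wf_part (tape_alphabet M i) (head_states M i) (\<theta> ! i))) \<and>
     state_vector M (start_states M) \<and> state_vector M (accept_states M)"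

definition is_config :: "('a, 'q) tm \<Rightarrow> ('a, 'q) config \<Rightarrow> bool" where
  "is_config M C \<longleftrightarrow> length C = num_tapes M \<and>
     (\<forall>i<num_tapes M. C ! i \<in>
        lists (tape_alphabet M i) \<times> head_states M i \<times> lists (tape_alphabet M i))"

definition part_step ::
    "('a, 'q) command_part \<Rightarrow> ('a, 'q) tape_config \<Rightarrow> ('a, 'q) tape_config \<Rightarrow> bool" where
  "part_step p t t' \<longleftrightarrow>
     (\<exists>x y. t = (x @ left_old p, state_old p, right_old p @ y) \<and>
            t' = (x @ left_new p, state_new p, right_new p @ y) \<and>
            (at_left p \<longrightarrow> x = []) \<and> (at_right p \<longrightarrow> y = []))"

definition command_step ::
    "('a, 'q) tm_command \<Rightarrow> ('a, 'q) config \<Rightarrow> ('a, 'q) config \<Rightarrow> bool" where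
  "command_step \<theta> C C' \<longleftrightarrow> length C = length \<theta> \<and> length C' = length \<theta> \<and>
     (\<forall>i<length \<theta>. part_step (\<theta> ! i) (C ! i) (C' ! i))"

definition tm_step :: "('a, 'q) tm \<Rightarrow> ('a, 'q) config \<Rightarrow> ('a, 'q) config \<Rightarrow> bool" where
  "tm_step M C C' \<longleftrightarrow> (\<exists>\<theta>\<in>tm_commands M. command_step \<theta> C C')"

definition applicable :: "('a, 'q) tm_command \<Rightarrow> ('a, 'q) config \<Rightarrow> bool" where
  "applicable \<theta> C \<longleftrightarrow> (\<exists>C'. command_step \<theta> C C')"

definition deterministic :: "('a, 'q) tm \<Rightarrow> bool" where
  "deterministic M \<longleftrightarrow>
     (\<forall>C. is_config M C \<longrightarrow>
        (\<forall>\<theta>\<in>tm_commands M. \<forall>\<theta>'\<in>tm_commands M.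
           applicable \<theta> C \<and> applicable \<theta>' C \<longrightarrow> \<theta> = \<theta>'))"

definition input_config :: "('a, 'q) tm \<Rightarrow> 'a list \<Rightarrow> ('a, 'q) config" where
  "input_config M u =
     map (\<lambda>i. (if i = 0 then u else [], start_states M ! i, [])) [0..<num_tapes M]"

definition empty_config :: "'q list \<Rightarrow> ('a, 'q) config" where
  "empty_config qs = map (\<lambda>q. ([], q, [])) qs"

definition accept_config :: "('a, 'q) tm \<Rightarrow> ('a, 'q) config \<Rightarrow> bool" where
  "accept_config M C \<longleftrightarrow> C = empty_config (accept_states M)"

definition reject_config :: "('a, 'q) tm \<Rightarrow> ('a, 'q) config \<Rightarrow> bool" where
  "reject_config M C \<longleftrightarrow>
     (\<exists>qs. qs \<noteq> accept_states M \<and> C = empty_config qs) \<and> \<not> (\<exists>C'. tm_step M C C')"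

definition computation :: "('a, 'q) tm \<Rightarrow> 'a list \<Rightarrow> ('a, 'q) config list \<Rightarrow> bool" where
  "computation M u Cs \<longleftrightarrow>
     Cs \<noteq> [] \<and> hd Cs = input_config M u \<and> successively (tm_step M) Cs"

definition accepting_computation :: "('a, 'q) tm \<Rightarrow> 'a list \<Rightarrow> ('a, 'q) config list \<Rightarrow> bool" where
  "accepting_computation M u Cs \<longleftrightarrow> computation M u Cs \<and> accept_config M (last Cs)"

definition rejecting_computation :: "('a, 'q) tm \<Rightarrow> 'a list \<Rightarrow> ('a, 'q) config list \<Rightarrow> bool" where
  "rejecting_computation M u Cs \<longleftrightarrow> computation M u Cs \<and> reject_config M (last Cs)"

definition accepts :: "('a, 'q) tm \<Rightarrow> 'a list \<Rightarrow> bool" where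
  "accepts M u \<longleftrightarrow> (\<exists>Cs. accepting_computation M u Cs)"

definition rejects :: "('a, 'q) tm \<Rightarrow> 'a list \<Rightarrow> bool" where
  "rejects M u \<longleftrightarrow> (\<exists>Cs. rejecting_computation M u Cs)"

definition config_space :: "('a, 'q) config \<Rightarrow> nat" where
  "config_space C = (\<Sum>(u, q, v)\<leftarrow>C. length u + length v)"

definition computation_space :: "('a, 'q) config list \<Rightarrow> nat" where
  "computation_space Cs = Max (config_space ` set Cs)"

definition word_space :: "('a, 'q) tm \<Rightarrow> 'a list \<Rightarrow> nat" where
  "word_space M u =
     (LEAST s. \<exists>Cs. (accepting_computation M u Cs \<or> rejecting_computation M u Cs) \<and>
                    computation_space Cs = s)"

definition space_complexity :: "('a, 'q) tm \<Rightarrow> nat \<Rightarrow> nat" where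
  "space_complexity M n =
     Sup {word_space M u | u. u \<in> lists (input_alphabet M) \<and> length u \<le> n}"

end

theory Submission imports Defs begin

text \<open>
  The letters of the presentation are cells, end marks and the heads of a sweeping machine
  that simulates \<open>M\<close> in a list of cells, each with room for one letter of the input and
  one letter of each of the two stacks that make up a tape of \<open>M\<close>. To perform a command,
  the head sweeps to the left, collecting a bounded number of letters from the top of each
  stack, and back to the right, putting the new letters on top. If the cells do not suffice, it
  adds one blank cell at the right end, erases everything except the input, and starts the
  computation of \<open>M\<close> afresh. If the computation ends, it deletes all cells. The relations
  are the moves of this machine.

  Restarting is what tames the words that no input leads to. A word with one head may describe
  a configuration that \<open>M\<close> never reaches, and its computation may be long. But it does not
  grow before its first restart; from then on it is stuck, for want of a left end mark, or an
  honest computation on an input no longer than the word, and it grows only while it has less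
  space than \<open>M\<close> needs for this input (\<open>uncut_orbit_bounded\<close>). Whether it ever halts does not matter: as the machine is
  deterministic, two words with one head are equal only if they have a common descendant
  (\<open>equal_in_imp_common_descendant\<close>), and going down to it and up again takes no more
  space than the two computations.

  A cell content is a different letter on the left and on the right of a head, so that an
  arbitrary word falls into blocks, each with at most one head, which are rewritten independently
  (\<open>rewrite_step_cut\<close>). Rewriting them one after the other, a derivation needs the
  additional space of a single block only (\<open>joined_if_orbits_bounded\<close>). Hence the space
  function of the presentation is at most the space complexity of \<open>M\<close> plus a linear
  function.

  Conversely, the word for an input leads to a fixed word that admits no further move. Every
  derivation between them passes through all words of the computation
  (\<open>joined_through_path\<close>). Among these is the one in which the simulation halts, and its
  cells have held all configurations of the run of \<open>M\<close>, so that its length is at least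
  proportional to the space of the input.
\<close>

section \<open>Derivations of bounded space\<close>

definition joined :: "('b list \<times> 'b list) set \<Rightarrow> nat \<Rightarrow> 'b list \<Rightarrow> 'b list \<Rightarrow> bool" where
  "joined R s w w' \<longleftrightarrow>
     length w \<le> s \<and> (\<lambda>x y. rewrite_step R x y \<and> length y \<le> s)\<^sup>*\<^sup>* w w'"

lemma ex_path_iff_rtranclp:
  "(\<exists>ws. ws \<noteq> [] \<and> hd ws = x \<and> last ws = y \<and> successively P ws \<and> (\<forall>z\<in>set ws. S z)) \<longleftrightarrow>
   S x \<and> (\<lambda>x y. P x y \<and> S y)\<^sup>*\<^sup>* x y" (is "?L x \<longleftrightarrow> ?R x")
proof
  assume "?L x"
  then obtain ws where "ws \<noteq> []" "hd ws = x" "last ws = y" "successively P ws" "\<forall>z\<in>set ws. S z"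
    by blast
  then show "?R x"
  proof (induction ws arbitrary: x rule: induct_list012)
    case (3 a b ws)
    then have "S b \<and> (\<lambda>x y. P x y \<and> S y)\<^sup>*\<^sup>* b y" by simp
    with 3 show ?case by (auto intro: converse_rtranclp_into_rtranclp)
  qed auto
next
  assume r: "?R x"
  then have "(\<lambda>x y. P x y \<and> S y)\<^sup>*\<^sup>* x y" and "S x" by auto
  then show "?L x"
  proof (induction rule: converse_rtranclp_induct)
    case base
    then show ?case by (intro exI[of _ "[y]"]) auto
  next
    case (step x z)
    then obtain ws where ws: "ws \<noteq> []" "hd ws = z" "last ws = y" "successively P ws"
      "\<forall>z\<in>set ws. S z" by auto
    with step show ?case by (intro exI[of _ "x # ws"]) (auto simp: successively_Cons)
  qed
qed

lemma equal_in_iff_rtranclp: "equal_in R w w' \<longleftrightarrow> (rewrite_step R)\<^sup>*\<^sup>* w w'"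
  using ex_path_iff_rtranclp[of w w' "rewrite_step R" "\<lambda>_. True"]
  by (simp add: equal_in_def derivation_def)

lemma joined_iff_derivation:
  "joined R s w w' \<longleftrightarrow> (\<exists>ws. derivation R w w' ws \<and> derivation_space ws \<le> s)"
  using ex_path_iff_rtranclp[of w w' "rewrite_step R" "\<lambda>x. length x \<le> s"]
  by (auto simp: joined_def derivation_def derivation_space_def)

lemma pair_space_le: "joined R s w w' \<Longrightarrow> pair_space R w w' \<le> s"
  unfolding joined_iff_derivation pair_space_def by (blast intro: Least_le le_trans)

lemma joined_pair_space: "equal_in R w w' \<Longrightarrow> joined R (pair_space R w w') w w'"
proof -
  assume "equal_in R w w'"
  then have "\<exists>s ws. derivation R w w' ws \<and> derivation_space ws = s"
    by (simp add: equal_in_def)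
  from LeastI_ex[OF this] show ?thesis
    unfolding joined_iff_derivation pair_space_def by auto
qed

lemma rewrite_step_sym: "rewrite_step R w w' \<Longrightarrow> rewrite_step R w' w"
  unfolding rewrite_step_def by metis

lemma rewrite_step_context: "rewrite_step R w w' \<Longrightarrow> rewrite_step R (u @ w @ v) (u @ w' @ v)"
  unfolding rewrite_step_def by (metis append.assoc)

lemma joined_refl: "length w \<le> s \<Longrightarrow> joined R s w w"
  by (simp add: joined_def)

lemma joined_length: "joined R s w w' \<Longrightarrow> length w' \<le> s"
  unfolding joined_def by (auto elim: rtranclp.cases)

lemma joined_step: "rewrite_step R w w' \<Longrightarrow> length w \<le> s \<Longrightarrow> length w' \<le> s \<Longrightarrow> joined R s w w'"
  by (auto simp: joined_def)

lemma joined_trans: "joined R s w w' \<Longrightarrow> joined R s w' w'' \<Longrightarrow> joined R s w w''"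
  by (auto simp: joined_def)

lemma joined_sym:
  assumes "joined R s w w'"
  shows "joined R s w' w"
proof -
  have "(\<lambda>x y. rewrite_step R x y \<and> length y \<le> s)\<^sup>*\<^sup>* w w'" and "length w \<le> s"
    using assms by (auto simp: joined_def)
  then show ?thesis
  proof (induction rule: rtranclp_induct)
    case (step y z)
    from step have "joined R s y w" by simp
    moreover from this have "length y \<le> s" by (simp add: joined_def)
    ultimately show ?case
      using step.hyps by (blast intro: joined_trans joined_step rewrite_step_sym)
  qed (simp add: joined_refl)
qed

lemma joined_context:
  assumes "joined R s w w'"
  shows "joined R (length u + s + length v) (u @ w @ v) (u @ w' @ v)"
proof -
  have "(\<lambda>x y. rewrite_step R x y \<and> length y \<le> s)\<^sup>*\<^sup>* w w'" and "length w \<le> s"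
    using assms by (auto simp: joined_def)
  then show ?thesis
  proof (induction rule: rtranclp_induct)
    case (step y z)
    then have "joined R (length u + s + length v) (u @ w @ v) (u @ y @ v)" by simp
    moreover have "rewrite_step R (u @ y @ v) (u @ z @ v)"
      using step by (simp add: rewrite_step_context)
    ultimately show ?case
      using step.hyps(2) joined_length[of R _ _ "u @ y @ v"]
        joined_step[of R "u @ y @ v" "u @ z @ v" "length u + s + length v"] by (auto intro: joined_trans)
  qed (simp add: joined_refl)
qed

lemma joined_mono: "joined R s w w' \<Longrightarrow> s \<le> s' \<Longrightarrow> joined R s' w w'"
  unfolding joined_iff_derivation by (blast intro: le_trans)

text \<open>
  An injective renaming of the letters is inverted by another renaming, so it suffices that
  renaming carries derivations to derivations of the same space.
\<close>

lemma derivation_rename: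
  assumes "derivation R w w' ws"
  shows "derivation (map_prod (map g) (map g) ` R) (map g w) (map g w') (map (map g) ws)"
    and "derivation_space (map (map g) ws) = derivation_space ws"
proof -
  let ?R = "map_prod (map g) (map g) ` R"
  have "rewrite_step ?R (map g x) (map g y)" if "rewrite_step R x y" for x y
  proof -
    from that obtain u v r r' where *: "(r, r') \<in> R \<or> (r', r) \<in> R" "x = u @ r @ v" "y = u @ r' @ v"
      unfolding rewrite_step_def by blast
    then have "(map g r, map g r') \<in> ?R \<or> (map g r', map g r) \<in> ?R" by force
    with * show ?thesis unfolding rewrite_step_def by (metis map_append)
  qed
  then show "derivation ?R (map g w) (map g w') (map (map g) ws)"
    using assms unfolding derivation_def
    by (auto simp: successively_map hd_map last_map intro: successively_mono)
  show "derivation_space (map (map g) ws) = derivation_space ws"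
    by (simp add: derivation_space_def image_image)
qed

lemma rename_presentation:
  fixes A :: "'b set"
  assumes A: "finite A" and R: "R \<subseteq> lists A \<times> lists A"
  obtains g :: "'b \<Rightarrow> nat" and R' where
    "R' = map_prod (map g) (map g) ` R"
    "\<And>w w'. w \<in> lists A \<Longrightarrow> w' \<in> lists A \<Longrightarrow>
       equal_in R' (map g w) (map g w') = equal_in R w w' \<and>
       pair_space R' (map g w) (map g w') = pair_space R w w'"
proof -
  obtain g :: "'b \<Rightarrow> nat" where g: "inj_on g A"
    using finite_imp_inj_to_nat_seg[OF A] by blast
  define R' where "R' = map_prod (map g) (map g) ` R"
  define h where "h = inv_into A g"
  have hg: "map h (map g w) = w" if "w \<in> lists A" for w
    using that g by (auto simp: h_def intro!: map_idI)
  have "map_prod (map h) (map h) ` R' = (\<lambda>p. p) ` R"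
    unfolding R'_def image_image
  proof (rule image_cong)
    fix p assume "p \<in> R"
    with R have "fst p \<in> lists A" "snd p \<in> lists A" by auto
    with hg show "map_prod (map h) (map h) (map_prod (map g) (map g) p) = p"
      by (cases p) simp
  qed simp
  then have R'h: "map_prod (map h) (map h) ` R' = R" by simp
  have derv: "(\<exists>ws. derivation R' (map g w) (map g w') ws \<and> derivation_space ws = s) \<longleftrightarrow>
        (\<exists>ws. derivation R w w' ws \<and> derivation_space ws = s)"
    if "w \<in> lists A" "w' \<in> lists A" for w w' s
  proof (intro iffI; elim exE conjE)
    fix ws assume "derivation R' (map g w) (map g w') ws" "derivation_space ws = s"
    then show "\<exists>ws. derivation R w w' ws \<and> derivation_space ws = s"
      using derivation_rename[of R' "map g w" "map g w'" ws h] that hg R'h by auto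
  next
    fix ws assume "derivation R w w' ws" "derivation_space ws = s"
    then show "\<exists>ws. derivation R' (map g w) (map g w') ws \<and> derivation_space ws = s"
      using derivation_rename[of R w w' ws g] by (auto simp: R'_def)
  qed
  then have "equal_in R' (map g w) (map g w') = equal_in R w w' \<and>
      pair_space R' (map g w) (map g w') = pair_space R w w'"
    if "w \<in> lists A" "w' \<in> lists A" for w w'
  proof -
    note * = derv[OF that]
    have "Ex (derivation R' (map g w) (map g w')) = Ex (derivation R w w')"
      by (metis *)
    then show ?thesis by (simp only: equal_in_def pair_space_def *)
  qed
  then show ?thesis using that[OF R'_def] by blast
qed

section \<open>Sweeping systems\<close>

text \<open>
  A block is a head between cells, with optional end marks. The same cell content is a
  different letter on either side of the head, so that a word tells which head each cell
  belongs to.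
\<close>

datatype ('c, 's) letter = LMark | RMark | LCell 'c | RCell 'c | Head 's

definition rstep :: "('b list \<times> 'b list) set \<Rightarrow> 'b list \<Rightarrow> 'b list \<Rightarrow> bool" where
  "rstep R w w' \<longleftrightarrow> (\<exists>u v r r'. (r, r') \<in> R \<and> w = u @ r @ v \<and> w' = u @ r' @ v)"

lemma rewrite_step_iff_rstep: "rewrite_step R w w' \<longleftrightarrow> rstep R w w' \<or> rstep R w' w"
  unfolding rewrite_step_def rstep_def by blast

lemma rstepI: "(r, r') \<in> R \<Longrightarrow> rstep R (u @ r @ v) (u @ r' @ v)"
  unfolding rstep_def by blast

text \<open>
  Two letters are linked if they can be neighbours in one block; between letters that are not,
  a word can be cut.
\<close>

fun linked :: "('c, 's) letter \<Rightarrow> ('c, 's) letter \<Rightarrow> bool" where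
  "linked LMark (LCell c) = True"
| "linked LMark (Head s) = True"
| "linked (LCell c) (LCell c') = True"
| "linked (LCell c) (Head s) = True"
| "linked (Head s) (RCell c) = True"
| "linked (Head s) RMark = True"
| "linked (RCell c) (RCell c') = True"
| "linked (RCell c) RMark = True"
| "linked x y = False"

abbreviation uncut :: "('c, 's) letter list \<Rightarrow> bool" where
  "uncut \<equiv> successively linked"

fun is_Head :: "('c, 's) letter \<Rightarrow> bool" where
  "is_Head (Head s) = True"
| "is_Head x = False"

lemma linked_cells [simp]:
  "uncut (map LCell cs)" "uncut (map RCell cs)"
  "uncut (Head s # map RCell cs)"  "uncut (map LCell cs @ [Head s])"
  "uncut (map RCell cs @ [RMark])" "uncut (Head s # map RCell cs @ [RMark])"
proof -
  have "successively (\<lambda>_ _. True) cs" for cs :: "'a list"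
    by (induction cs rule: induct_list012) auto
  then show *: "uncut (map LCell cs)" "uncut (map RCell cs)" for cs :: "'a list"
    by (simp_all add: successively_map)
  show **: "uncut (Head s # map RCell cs)" "uncut (map LCell cs @ [Head s])"
    "uncut (map RCell cs @ [RMark])"
    by (cases "cs = []"; simp add: successively_append_iff successively_Cons * hd_map last_map)+
  show "uncut (Head s # map RCell cs @ [RMark])"
    using **(3) by (cases cs) simp_all
qed

lemma uncut_right_of_head:
  assumes "uncut (z # y)" and "\<And>x. linked z x \<Longrightarrow> (\<exists>c. x = RCell c) \<or> x = RMark"
  shows "(\<exists>cs. y = map RCell cs) \<or> (\<exists>cs. y = map RCell cs @ [RMark])"
  using assms
proof (induction y arbitrary: z)
  case (Cons x y)
  then have "linked z x" by simp
  with Cons.prems(2) consider (cell) c where "x = RCell c" | (mark) "x = RMark" by blast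
  then show ?case
  proof cases
    case cell
    have "(\<exists>cs. y = map RCell cs) \<or> (\<exists>cs. y = map RCell cs @ [RMark])"
    proof (rule Cons.IH[of x])
      fix x' assume "linked x x'" then show "(\<exists>c. x' = RCell c) \<or> x' = RMark"
        using cell by (cases x') auto
    qed (use Cons.prems in auto)
    then show ?thesis
    proof (elim disjE exE)
      fix cs assume "y = map RCell cs"
      then have "x # y = map RCell (c # cs)" using cell by simp
      then show ?thesis by (rule disjI1[OF exI])
    next
      fix cs assume "y = map RCell cs @ [RMark]"
      then have "x # y = map RCell (c # cs) @ [RMark]" using cell by simp
      then show ?thesis by (rule disjI2[OF exI])
    qed
  next
    case mark
    then have "y = []" using Cons.prems(1) by (cases y) auto
    then have "x # y = map RCell [] @ [RMark]" using mark by simp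
    then show ?thesis by (rule disjI2[OF exI])
  qed
qed auto

lemma uncut_left_of_head:
  assumes "uncut (x @ [z])" and "\<And>y. linked y z \<Longrightarrow> (\<exists>c. y = LCell c) \<or> y = LMark"
  shows "(\<exists>cs. x = map LCell cs) \<or> (\<exists>cs. x = LMark # map LCell cs)"
  using assms
proof (induction x arbitrary: z rule: rev_induct)
  case (snoc y x)
  then have l: "linked y z" "uncut (x @ [y])"
    by (auto simp: successively_append_iff)
  with snoc.prems(2) consider (cell) c where "y = LCell c" | (mark) "y = LMark" by blast
  then show ?case
  proof cases
    case cell
    have "(\<exists>cs. x = map LCell cs) \<or> (\<exists>cs. x = LMark # map LCell cs)"
    proof (rule snoc.IH[of y])
      fix x' assume "linked x' y" then show "(\<exists>c. x' = LCell c) \<or> x' = LMark"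
        using cell by (cases x') auto
    qed (use l in auto)
    then show ?thesis
    proof (elim disjE exE)
      fix cs assume "x = map LCell cs"
      then have "x @ [y] = map LCell (cs @ [c])" using cell by simp
      then show ?thesis by (rule disjI1[OF exI])
    next
      fix cs assume "x = LMark # map LCell cs"
      then have "x @ [y] = LMark # map LCell (cs @ [c])" using cell by simp
      then show ?thesis by (rule disjI2[OF exI])
    qed
  next
    case mark
    have "\<not> linked y' LMark" for y' :: "('a, 'b) letter" by (cases y') auto
    then have "x = []" using l(2) mark by (auto simp: successively_append_iff)
    then show ?thesis using mark by auto
  qed
qed auto

lemma uncut_around_head:
  assumes "uncut (x @ Head s # y)"
  shows "(\<exists>cs. x = map LCell cs) \<or> (\<exists>cs. x = LMark # map LCell cs)"
    and "(\<exists>cs. y = map RCell cs) \<or> (\<exists>cs. y = map RCell cs @ [RMark])"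
proof -
  have "uncut (x @ [Head s])" "uncut (Head s # y)"
    using assms by (auto simp: successively_append_iff)
  moreover have "(\<exists>c. z = LCell c) \<or> z = LMark" if "linked z (Head s)"
    for z :: "('a, 'b) letter"
    using that by (cases z) auto
  moreover have "(\<exists>c. z = RCell c) \<or> z = RMark" if "linked (Head s) z"
    for z :: "('a, 'b) letter"
    using that by (cases z) auto
  ultimately show "(\<exists>cs. x = map LCell cs) \<or> (\<exists>cs. x = LMark # map LCell cs)"
    "(\<exists>cs. y = map RCell cs) \<or> (\<exists>cs. y = map RCell cs @ [RMark])"
    using uncut_left_of_head[of x "Head s"] uncut_right_of_head[of "Head s" y] by blast+
qed

text \<open>
  A word without cuts has at most one head, as only cells and a mark can follow a head, and only
  cells and a mark can precede it.
\<close>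

lemma uncut_unique_head:
  assumes "uncut (x @ Head s # y)" and "x @ Head s # y = x' @ Head s' # y'"
  shows "x = x' \<and> s = s' \<and> y = y'"
proof -
  have nh: "takeWhile (\<lambda>z. \<not> is_Head z) (u @ Head t # v) = u" if "uncut (u @ Head t # v)"
    for u v :: "('a, 'b) letter list" and t
    using uncut_around_head(1)[OF that] by (auto intro!: takeWhile_append2[THEN trans])
  have "x = x'" using nh[OF assms(1)] nh[of x' s' y'] assms by simp
  with assms(2) show ?thesis by simp
qed

text \<open>
  The left-hand side is the head with its neighbour on the side to which the head moves, so that
  a block has at most one place for a rule. The first letters of both sides have the same links
  to the left, the last letters the same links to the right, so that rules preserve cuts.
\<close>

inductive sweep_rule ::
    "('s \<Rightarrow> bool) \<Rightarrow> ('c, 's) letter list \<Rightarrow> ('c, 's) letter list \<Rightarrow> bool"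
  for rightward where
  right_cell: "rightward s \<Longrightarrow>
    sweep_rule rightward [Head s, RCell c] (map LCell cs @ [Head s'])"
| right_mark: "rightward s \<Longrightarrow>
    sweep_rule rightward [Head s, RMark] (Head s' # map RCell cs @ [RMark])"
| left_cell: "\<not> rightward s \<Longrightarrow>
    sweep_rule rightward [LCell c, Head s] (Head s' # map RCell cs)"
| left_mark: "\<not> rightward s \<Longrightarrow>
    sweep_rule rightward [LMark, Head s] [LMark, Head s']"

locale sweeping_system =
  fixes R :: "(('c, 's) letter list \<times> ('c, 's) letter list) set"
    and rightward :: "'s \<Rightarrow> bool"
  assumes rule_form: "(l, r) \<in> R \<Longrightarrow> sweep_rule rightward l r"
    and rule_functional: "(l, r) \<in> R \<Longrightarrow> (l, r') \<in> R \<Longrightarrow> r = r'"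
begin

lemma rule_sides:
  assumes "(l, r) \<in> R"
  shows "l \<noteq> []" "r \<noteq> []" "uncut l" "uncut r"
    "linked x (hd l) = linked x (hd r)" "linked (last l) y = linked (last r) y"
proof -
  have "l \<noteq> [] \<and> r \<noteq> [] \<and> uncut l \<and> uncut r \<and> linked x (hd l) = linked x (hd r) \<and>
    linked (last l) y = linked (last r) y"
    using rule_form[OF assms]
  proof cases
    case (right_cell s c cs s')
    moreover have "uncut (map LCell cs @ [Head s'])" by simp
    ultimately show ?thesis by (cases x; cases y; cases cs; simp del: linked_cells)
  next
    case (right_mark s s' cs)
    then show ?thesis by (cases x; cases y; simp)
  next
    case (left_cell s c s' cs)
    moreover have "uncut (Head s' # map RCell cs)" by simp
    ultimately show ?thesis
      by (cases x; cases y; cases cs rule: rev_cases; simp del: linked_cells)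
  next
    case (left_mark s s')
    then show ?thesis by (cases x; cases y; simp)
  qed
  then show "l \<noteq> []" "r \<noteq> []" "uncut l" "uncut r"
    "linked x (hd l) = linked x (hd r)" "linked (last l) y = linked (last r) y"
    by blast+
qed

lemma rewrite_step_cases:
  assumes "rewrite_step R w w'"
  obtains u v l r where "w = u @ l @ v" "w' = u @ r @ v" "l \<noteq> []" "r \<noteq> []" "uncut l" "uncut r"
    "\<And>x. linked x (hd l) = linked x (hd r)" "\<And>y. linked (last l) y = linked (last r) y"
    "rewrite_step R l r"
proof -
  from assms obtain u v l r where *: "(l, r) \<in> R \<or> (r, l) \<in> R" "w = u @ l @ v" "w' = u @ r @ v"
    unfolding rewrite_step_def by blast
  then have "rewrite_step R l r" unfolding rewrite_step_def by (metis append_Nil append_Nil2)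
  moreover have "l \<noteq> []" "r \<noteq> []" "uncut l" "uncut r"
    "\<And>x. linked x (hd l) = linked x (hd r)" "\<And>y. linked (last l) y = linked (last r) y"
    using *(1) rule_sides by blast+
  ultimately show ?thesis using that * by blast
qed

lemma rewrite_step_uncut: "rewrite_step R w w' \<Longrightarrow> uncut w \<Longrightarrow> uncut w'"
  by (erule rewrite_step_cases) (auto simp: successively_append_iff)

lemma equal_in_uncut: "equal_in R w w' \<Longrightarrow> uncut w \<Longrightarrow> uncut w'"
  unfolding equal_in_iff_rtranclp by (induction rule: rtranclp_induct) (auto dest: rewrite_step_uncut)

definition severed :: "('c, 's) letter list \<Rightarrow> ('c, 's) letter list \<Rightarrow> bool" where
  "severed x y \<longleftrightarrow> x \<noteq> [] \<and> y \<noteq> [] \<and> \<not> linked (last x) (hd y)"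

text \<open>
  Both sides of a rule are uncut, so an occurrence of one cannot straddle a cut, and the cut
  survives because the outer letters keep their links.
\<close>

lemma rewrite_step_cut:
  assumes "rewrite_step R (x @ y) w" and "severed x y"
  shows "(\<exists>x'. w = x' @ y \<and> rewrite_step R x x' \<and> severed x' y) \<or>
         (\<exists>y'. w = x @ y' \<and> rewrite_step R y y' \<and> severed x y')"
  using assms(1)
proof (rule rewrite_step_cases)
  fix u v l r
  assume *: "x @ y = u @ l @ v" "w = u @ r @ v" "l \<noteq> []" "r \<noteq> []" "uncut l" "uncut r"
    and hd: "\<And>x. linked x (hd l) = linked x (hd r)"
    and last: "\<And>y. linked (last l) y = linked (last r) y"
    and step: "rewrite_step R l r"
  have ctx: "rewrite_step R (a @ l @ b) (a @ r @ b)" for a b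
    using step by (rule rewrite_step_context)
  from *(1) consider (right) us where "u = x @ us" "y = us @ l @ v"
    | (left) us where "x = u @ us" "l @ v = us @ y"
    by (auto simp: append_eq_append_conv2)
  then show ?thesis
  proof cases
    case right
    then have "severed x (us @ r @ v)"
      using \<open>severed x y\<close> *(3,4) hd by (cases us) (auto simp: severed_def)
    moreover have "w = x @ us @ r @ v" "rewrite_step R y (us @ r @ v)"
      using right *(2) ctx[of us v] by simp_all
    ultimately show ?thesis by blast
  next
    case left
    from left(2) consider (in_x) zs where "us = l @ zs" "v = zs @ y"
      | (across) zs where "l = us @ zs" "y = zs @ v"
      by (auto simp: append_eq_append_conv2)
    then show ?thesis
    proof cases
      case in_x
      then have "severed (u @ r @ zs) y"
        using \<open>severed x y\<close> *(3,4) last left(1) by (cases zs rule: rev_cases) (auto simp: severed_def)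
      moreover have "w = (u @ r @ zs) @ y" "rewrite_step R x (u @ r @ zs)"
        using left(1) in_x *(2) ctx[of u zs] by simp_all
      ultimately show ?thesis by blast
    next
      case across
      show ?thesis
      proof (cases "us = [] \<or> zs = []")
        case True
        then show ?thesis
        proof
          assume "us = []"
          then have "y = l @ v" "x = u" using left(1) across by simp_all
          then have "severed x (r @ v)" using \<open>severed x y\<close> *(3,4) hd by (simp add: severed_def)
          moreover have "w = x @ r @ v" "rewrite_step R y (r @ v)"
            using \<open>y = l @ v\<close> \<open>x = u\<close> *(2) ctx[of "[]" v] by simp_all
          ultimately show ?thesis by blast
        next
          assume "zs = []"
          then have "y = v" "x = u @ l" using left(1) across by simp_all
          then have "severed (u @ r) y" using \<open>severed x y\<close> *(3,4) last by (simp add: severed_def)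
          moreover have "w = (u @ r) @ y" "rewrite_step R x (u @ r)"
            using \<open>y = v\<close> \<open>x = u @ l\<close> *(2) ctx[of u "[]"] by simp_all
          ultimately show ?thesis by blast
        qed
      next
        case False
        then have "linked (last x) (hd y)"
          using across left(1) *(5) by (simp add: successively_append_iff)
        then show ?thesis using \<open>severed x y\<close> by (simp add: severed_def)
      qed
    qed
  qed
qed

lemma equal_in_cut:
  assumes "equal_in R (x @ y) w" and "severed x y"
  shows "\<exists>x' y'. w = x' @ y' \<and> equal_in R x x' \<and> equal_in R y y'"
proof -
  have "\<exists>x' y'. w = x' @ y' \<and> severed x' y' \<and> equal_in R x x' \<and> equal_in R y y'"
    using assms unfolding equal_in_iff_rtranclp
  proof (induction rule: rtranclp_induct)
    case (step w w')
    then obtain x' y' where *: "w = x' @ y'" "severed x' y'"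
      "(rewrite_step R)\<^sup>*\<^sup>* x x'" "(rewrite_step R)\<^sup>*\<^sup>* y y'" by blast
    from rewrite_step_cut[OF step.hyps(2)[unfolded *(1)] *(2)] show ?case
    proof (elim disjE exE conjE)
      fix x'' assume "w' = x'' @ y'" "rewrite_step R x' x''" "severed x'' y'"
      then show ?thesis using *(4) rtranclp.rtrancl_into_rtrancl[OF *(3)] by blast
    next
      fix y'' assume "w' = x' @ y''" "rewrite_step R y' y''" "severed x' y''"
      then show ?thesis using *(3) rtranclp.rtrancl_into_rtrancl[OF *(4)] by blast
    qed
  qed auto
  then show ?thesis by blast
qed

lemma not_uncut_imp_cut:
  assumes "\<not> uncut w"
  obtains x y where "w = x @ y" "severed x y"
proof -
  have "\<exists>x y. w = x @ y \<and> severed x y" using assms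
  proof (induction w rule: induct_list012)
    case (3 a b w)
    show ?case
    proof (cases "linked a b")
      case True
      with 3 obtain x y where "b # w = x @ y" "severed x y" by auto
      then show ?thesis by (intro exI[of _ "a # x"] exI[of _ y]) (auto simp: severed_def)
    next
      case False
      then show ?thesis by (intro exI[of _ "[a]"] exI[of _ "b # w"]) (auto simp: severed_def)
    qed
  qed auto
  then show ?thesis using that by blast
qed

lemma rstep_cases:
  assumes "rstep R w w'"
  obtains (right) x s z y r where "rightward s" "w = x @ Head s # z # y" "w' = x @ r @ y"
      "([Head s, z], r) \<in> R"
  | (left) x s z y r where "\<not> rightward s" "w = x @ z # Head s # y" "w' = x @ r @ y"
      "([z, Head s], r) \<in> R"
proof -
  from assms obtain u v l r where *: "(l, r) \<in> R" "w = u @ l @ v" "w' = u @ r @ v"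
    unfolding rstep_def by blast
  from rule_form[OF *(1)] show ?thesis
    by cases (use * that(1)[of _ u _ v r] that(2)[of _ u _ v r] in auto)
qed

lemma rstep_deterministic:
  assumes "uncut w" "rstep R w w1" "rstep R w w2"
  shows "w1 = w2"
  using assms(2)
proof (cases rule: rstep_cases)
  case (right x s z y r)
  from assms(3) show ?thesis
  proof (cases rule: rstep_cases)
    case (right x' s' z' y' r')
    then have "x = x' \<and> s = s' \<and> z # y = z' # y'"
      using uncut_unique_head[of x s "z # y"] assms(1) \<open>w = x @ Head s # z # y\<close> by auto
    then show ?thesis using right \<open>w1 = x @ r @ y\<close> \<open>([Head s, z], r) \<in> R\<close> rule_functional by blast
  next
    case (left x' s' z' y' r')
    then have "s = s'"
      using uncut_unique_head[of x s "z # y" "x' @ [z']" s' y'] assms(1) right by simp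
    then show ?thesis using left right by simp
  qed
next
  case (left x s z y r)
  from assms(3) show ?thesis
  proof (cases rule: rstep_cases)
    case (right x' s' z' y' r')
    then have "s = s'"
      using uncut_unique_head[of "x @ [z]" s y x' s' "z' # y'"] assms(1) left by simp
    then show ?thesis using left right by simp
  next
    case (left x' s' z' y' r')
    then have "x @ [z] = x' @ [z'] \<and> s = s' \<and> y = y'"
      using uncut_unique_head[of "x @ [z]" s y "x' @ [z']" s' y'] assms(1)
        \<open>w = x @ z # Head s # y\<close> by simp
    then show ?thesis using left \<open>w1 = x @ r @ y\<close> \<open>([z, Head s], r) \<in> R\<close> rule_functional by simp
  qed
qed

lemma rsteps_uncut: "(rstep R)\<^sup>*\<^sup>* w w' \<Longrightarrow> uncut w \<Longrightarrow> uncut w'"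
  by (induction rule: rtranclp_induct) (use rewrite_step_uncut rewrite_step_iff_rstep in blast)+

text \<open>
  Extend the derivation by a step from \<open>w'\<close>. A step forward either starts at the common
  descendant and leads to a new one, or goes along the path to it, by determinism; a step
  backward prolongs this path.
\<close>

lemma equal_in_imp_common_descendant:
  assumes "equal_in R w w'" and "uncut w"
  shows "\<exists>z. (rstep R)\<^sup>*\<^sup>* w z \<and> (rstep R)\<^sup>*\<^sup>* w' z"
  using assms unfolding equal_in_iff_rtranclp
proof (induction rule: rtranclp_induct)
  case (step x y)
  then obtain z where z: "(rstep R)\<^sup>*\<^sup>* w z" "(rstep R)\<^sup>*\<^sup>* x z" by blast
  have "uncut x" using step.hyps(1) step.prems equal_in_uncut by (simp add: equal_in_iff_rtranclp)
  from step.hyps(2) consider "rstep R x y" | "rstep R y x" by (auto simp: rewrite_step_iff_rstep)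
  then show ?case
  proof cases
    case 1
    from z(2) show ?thesis
    proof (cases rule: converse_rtranclpE)
      case base
      then show ?thesis using 1 z by (meson rtranclp.rtrancl_into_rtrancl rtranclp.rtrancl_refl)
    next
      case (step x')
      then have "x' = y" using 1 rstep_deterministic[OF \<open>uncut x\<close>] by blast
      then show ?thesis using step z by blast
    qed
  next
    case 2
    then show ?thesis using z by (meson converse_rtranclp_into_rtranclp)
  qed
qed auto

definition orbit_bounded :: "nat \<Rightarrow> ('c, 's) letter list \<Rightarrow> bool" where
  "orbit_bounded B w \<longleftrightarrow> (\<forall>z. (rstep R)\<^sup>*\<^sup>* w z \<longrightarrow> length z \<le> B)"

lemma orbit_bounded_length: "orbit_bounded B w \<Longrightarrow> length w \<le> B"
  unfolding orbit_bounded_def by blast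

lemma orbit_bounded_step: "orbit_bounded B w \<Longrightarrow> rstep R w w' \<Longrightarrow> orbit_bounded B w'"
  unfolding orbit_bounded_def by (meson converse_rtranclp_into_rtranclp)

lemma orbit_boundedI:
  "length w \<le> B \<Longrightarrow> (\<And>w'. rstep R w w' \<Longrightarrow> orbit_bounded B w') \<Longrightarrow> orbit_bounded B w"
  unfolding orbit_bounded_def by (metis converse_rtranclpE)

lemma orbit_bounded_joined:
  assumes "orbit_bounded B w" and "(rstep R)\<^sup>*\<^sup>* w z"
  shows "joined R B w z"
  using assms(2)
proof (induction rule: rtranclp_induct)
  case base
  then show ?case using assms(1) by (simp add: joined_refl orbit_bounded_length)
next
  case (step y z)
  have "length y \<le> B" "length z \<le> B"
    using step.hyps assms(1) unfolding orbit_bounded_def by (auto intro: rtranclp.rtrancl_into_rtrancl)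
  with step show ?case
    by (meson joined_step joined_trans rewrite_step_iff_rstep)
qed

text \<open>
  The pieces of a word between its cuts are rewritten independently. Rewriting them one after
  the other, only one piece at a time is larger than it is in \<open>w\<close> or in \<open>w'\<close>; this is
  why the bound \<open>B\<close> for a single piece enters only once, however many pieces there are.
\<close>

theorem joined_if_orbits_bounded:
  assumes bounded: "\<And>z. uncut z \<Longrightarrow> length z \<le> n \<Longrightarrow> orbit_bounded B z"
    and "equal_in R w w'" "length w \<le> n" "length w' \<le> n"
  shows "joined R (length w + length w' + B) w w'"
  using assms(2-)
proof (induction "length w" arbitrary: w w' rule: less_induct)
  case less
  show ?case
  proof (cases "uncut w")
    case True
    obtain z where "(rstep R)\<^sup>*\<^sup>* w z" "(rstep R)\<^sup>*\<^sup>* w' z"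
      using equal_in_imp_common_descendant[OF less.prems(1) True] by blast
    moreover have "orbit_bounded B w" "orbit_bounded B w'"
      using True less.prems equal_in_uncut bounded by blast+
    ultimately have "joined R B w w'"
      by (meson joined_sym joined_trans orbit_bounded_joined)
    then show ?thesis by (rule joined_mono) simp
  next
    case False
    then obtain x y where xy: "w = x @ y" "severed x y" by (rule not_uncut_imp_cut)
    then obtain x' y' where xy': "w' = x' @ y'" "equal_in R x x'" "equal_in R y y'"
      using equal_in_cut less.prems(1) by blast
    have "length x < length w" "length y < length w" using xy by (auto simp: severed_def)
    then have "joined R (length x + length x' + B) x x'" "joined R (length y + length y' + B) y y'"
      using less xy xy' by auto
    from joined_context[OF this(1), of "[]" y] joined_context[OF this(2), of x' "[]"]
    have "joined R (length w + length w' + B) (x @ y) (x' @ y)"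
      "joined R (length w + length w' + B) (x' @ y) (x' @ y')"
      by (auto simp: xy xy' elim: joined_mono)
    then show ?thesis using joined_trans xy xy' by blast
  qed
qed

text \<open>
  Leaving the set of ancestors of \<open>z\<close> is possible only through \<open>z\<close> itself, so a derivation
  cannot avoid any word of the forward path to a word without successor.
\<close>

theorem joined_through_path:
  assumes "joined R s w y" "uncut w" "(rstep R)\<^sup>*\<^sup>* w z" "(rstep R)\<^sup>*\<^sup>* z y"
    and terminal: "\<And>y'. \<not> rstep R y y'"
  shows "length z \<le> s"
proof (rule ccontr)
  assume neg: "\<not> length z \<le> s"
  have walk: "(\<lambda>x y. rewrite_step R x y \<and> length y \<le> s)\<^sup>*\<^sup>* w y" "length w \<le> s"
    using assms(1) by (auto simp: joined_def)
  have "length v \<le> s \<and> uncut v \<and> (rstep R)\<^sup>*\<^sup>* v z"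
    if "(\<lambda>x y. rewrite_step R x y \<and> length y \<le> s)\<^sup>*\<^sup>* w v" for v
    using that
  proof (induction rule: rtranclp_induct)
    case (step v v')
    then have v: "length v \<le> s" "uncut v" "(rstep R)\<^sup>*\<^sup>* v z" by auto
    have "(rstep R)\<^sup>*\<^sup>* v' z"
    proof (cases "rstep R v v'")
      case True
      from v(3) show ?thesis
      proof (cases rule: converse_rtranclpE)
        case base
        then show ?thesis using neg v by simp
      next
        case (step v'')
        then show ?thesis using rstep_deterministic[OF v(2) True] by blast
      qed
    next
      case False
      then show ?thesis using step.hyps(2) v(3)
        by (auto simp: rewrite_step_iff_rstep intro: converse_rtranclp_into_rtranclp)
    qed
    then show ?case using step.hyps(2) v rewrite_step_uncut by blast
  qed (use assms walk in auto)
  from this[OF walk(1)] have "length y \<le> s" "(rstep R)\<^sup>*\<^sup>* y z" by auto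
  then have "y = z" using terminal by (metis converse_rtranclpE)
  then show False using neg \<open>length y \<le> s\<close> by simp
qed

definition reaches ::
    "nat \<Rightarrow> ('c, 's) letter list \<Rightarrow> ('c, 's) letter list \<Rightarrow> bool" where
  "reaches B w w' \<longleftrightarrow> length w \<le> B \<and> (\<lambda>x y. rstep R x y \<and> length y \<le> B)\<^sup>*\<^sup>* w w'"

lemma reaches_refl: "length w \<le> B \<Longrightarrow> reaches B w w"
  by (simp add: reaches_def)

lemma reaches_trans: "reaches B w w' \<Longrightarrow> reaches B w' w'' \<Longrightarrow> reaches B w w''"
  by (auto simp: reaches_def)

lemma reaches_step:
  assumes "(l, r) \<in> R" "length (u @ l @ v) \<le> B" "length (u @ r @ v) \<le> B"
  shows "reaches B (u @ l @ v) (u @ r @ v)"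
  using assms rstepI[OF assms(1), of u v] unfolding reaches_def by auto

lemma reaches_rsteps: "reaches B w w' \<Longrightarrow> (rstep R)\<^sup>*\<^sup>* w w'"
  unfolding reaches_def by (auto elim!: rtranclp_mono[THEN predicate2D, rotated])

text \<open>
  By determinism, a word on the orbit of \<open>w\<close> lies on the given path or on the orbit of its
  end.
\<close>

lemma reaches_orbit_bounded:
  assumes "reaches B w w'" "uncut w" "orbit_bounded B w'"
  shows "orbit_bounded B w"
proof -
  have "(\<lambda>x y. rstep R x y \<and> length y \<le> B)\<^sup>*\<^sup>* w w'" "length w \<le> B"
    using assms(1) by (auto simp: reaches_def)
  then show ?thesis
    using assms(2)
  proof (induction rule: converse_rtranclp_induct)
    case base
    show ?case by (rule assms(3))
  next
    case (step x y)
    then have "uncut y" using rsteps_uncut[of x y] by blast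
    with step have "orbit_bounded B y" by simp
    with step show ?case by (metis orbit_boundedI rstep_deterministic)
  qed
qed

end

section \<open>Configurations as families of stacks\<close>

text \<open>
  Tape \<open>i\<close> is a pair of stacks \<open>(i, False)\<close> and \<open>(i, True)\<close>, left and right of its
  head, both with their top at the head.
\<close>

definition stack :: "('a, 'q) config \<Rightarrow> nat \<times> bool \<Rightarrow> 'a list" where
  "stack C = (\<lambda>(i, right). if i < length C
     then (case C ! i of (u, q, v) \<Rightarrow> if right then v else rev u) else [])"

definition states :: "('a, 'q) config \<Rightarrow> 'q list" where
  "states C = map (\<lambda>(u, q, v). q) C"

definition assemble :: "nat \<Rightarrow> (nat \<times> bool \<Rightarrow> 'a list) \<Rightarrow> 'q list \<Rightarrow> ('a, 'q) config" where
  "assemble k b qs = map (\<lambda>i. (rev (b (i, False)), qs ! i, b (i, True))) [0..<k]"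

lemma length_assemble [simp]: "length (assemble k b qs) = k"
  by (simp add: assemble_def)

lemma length_states [simp]: "length (states C) = length C"
  by (simp add: states_def)

lemma nth_assemble: "i < k \<Longrightarrow> assemble k b qs ! i = (rev (b (i, False)), qs ! i, b (i, True))"
  by (simp add: assemble_def)

lemma stack_assemble: "stack (assemble k b qs) (i, r) = (if i < k then b (i, r) else [])"
  by (auto simp: stack_def nth_assemble)

lemma states_assemble: "length qs = k \<Longrightarrow> states (assemble k b qs) = qs"
  by (rule nth_equalityI) (auto simp: states_def nth_assemble)

lemma eq_empty_config_iff: "C = empty_config qs \<longleftrightarrow> states C = qs \<and> (\<forall>j. stack C j = [])"
proof
  assume "C = empty_config qs"
  then show "states C = qs \<and> (\<forall>j. stack C j = [])"
    by (auto simp: empty_config_def states_def stack_def comp_def)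
next
  assume *: "states C = qs \<and> (\<forall>j. stack C j = [])"
  have "C ! i = ([], qs ! i, [])" if "i < length C" for i
  proof -
    obtain u q v where Ci: "C ! i = (u, q, v)" by (cases "C ! i")
    have "stack C (i, False) = []" "stack C (i, True) = []" using * by blast+
    then have "u = []" "v = []" using that Ci by (auto simp: stack_def)
    moreover have "qs ! i = q" using * that Ci by (auto simp: states_def)
    ultimately show ?thesis using Ci by simp
  qed
  moreover have "length C = length qs" using * by auto
  ultimately show "C = empty_config qs"
    by (intro nth_equalityI) (auto simp: empty_config_def)
qed

lemma config_space_eq:
  "config_space C = (\<Sum>i<length C. length (stack C (i, False)) + length (stack C (i, True)))"
proof -
  have "config_space C = (\<Sum>i<length C. (\<lambda>(u, q, v). length u + length v) (C ! i))"
    by (simp add: config_space_def sum_list_sum_nth atLeast0LessThan)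
  also have "\<dots> = (\<Sum>i<length C. length (stack C (i, False)) + length (stack C (i, True)))"
    by (rule sum.cong) (auto simp: stack_def split: prod.splits)
  finally show ?thesis .
qed

lemma length_stack_le_config_space: "length (stack C j) \<le> config_space C"
proof (cases "fst j < length C")
  case True
  have "length (stack C j) \<le> length (stack C (fst j, False)) + length (stack C (fst j, True))"
    by (cases j; cases "snd j") auto
  also have "\<dots> \<le> config_space C"
    unfolding config_space_eq using True by (intro member_le_sum) auto
  finally show ?thesis .
next
  case False
  then show ?thesis by (auto simp: stack_def split: prod.splits)
qed

lemma config_space_le:
  assumes "\<And>j. length (stack C j) \<le> m"
  shows "config_space C \<le> 2 * length C * m"
proof -
  have "config_space C \<le> (\<Sum>i<length C. m + m)"
    unfolding config_space_eq by (intro sum_mono add_mono assms)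
  also have "\<dots> = 2 * length C * m" by simp
  finally show ?thesis .
qed

lemma stack_outside: "length C \<le> fst j \<Longrightarrow> stack C j = []"
  by (cases j) (simp add: stack_def)

lemma append_eq_suffix:
  assumes "u0 @ u = x @ w" and "length w \<le> length u"
  shows "\<exists>x'. x = u0 @ x' \<and> u = x' @ w"
proof -
  have "length u0 + length u = length x + length w"
    using arg_cong[OF assms(1), of length] by simp
  then have "length u0 \<le> length x" using assms(2) by simp
  then have "x = u0 @ take (length x - length u0) u"
    using arg_cong[OF assms(1), of "take (length x)"] by simp
  with assms(1) show ?thesis by (metis append.assoc same_append_eq)
qed

text \<open>
  An end test of a command concerns the visible part \<open>u\<close>, \<open>v\<close> of the tape only. If
  more of the tape is hidden, the strict inequalities ensure that the test fails on the visible
  part as well.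
\<close>

lemma part_step_extend:
  assumes "part_step p (u, q, v) (u', q', v')"
    and "u0 \<noteq> [] \<Longrightarrow> length (left_old p) < length u"
    and "v0 \<noteq> [] \<Longrightarrow> length (right_old p) < length v"
  shows "part_step p (u0 @ u, q, v @ v0) (u0 @ u', q', v' @ v0)"
proof -
  from assms(1) obtain x y where *: "u = x @ left_old p" "q = state_old p" "v = right_old p @ y"
    "u' = x @ left_new p" "q' = state_new p" "v' = right_new p @ y"
    "at_left p \<longrightarrow> x = []" "at_right p \<longrightarrow> y = []"
    by (auto simp: part_step_def)
  then have "at_left p \<longrightarrow> u0 @ x = []" "at_right p \<longrightarrow> y @ v0 = []"
    using assms(2,3) by fastforce+
  with * show ?thesis
    unfolding part_step_def by (intro exI[of _ "u0 @ x"] exI[of _ "y @ v0"]) simp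
qed

lemma part_step_restrict:
  assumes "part_step p (u0 @ u, q, v @ v0) t"
    and "u0 \<noteq> [] \<Longrightarrow> length (left_old p) < length u"
    and "v0 \<noteq> [] \<Longrightarrow> length (right_old p) < length v"
  shows "\<exists>t'. part_step p (u, q, v) t'"
proof -
  from assms(1) obtain x y where *: "u0 @ u = x @ left_old p" "q = state_old p"
    "v @ v0 = right_old p @ y" "at_left p \<longrightarrow> x = []" "at_right p \<longrightarrow> y = []"
    by (auto simp: part_step_def)
  have "length (left_old p) \<le> length u"
    using *(1) assms(2) by (cases "u0 = []") auto
  with *(1) obtain x' where x': "x = u0 @ x'" "u = x' @ left_old p"
    using append_eq_suffix by metis
  have "length (right_old p) \<le> length v"
    using *(3) assms(3) by (cases "v0 = []") auto
  with *(3) obtain y' where y': "y = y' @ v0" "v = right_old p @ y'"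
    using append_eq_suffix[of "rev v0" "rev v" "rev y" "rev (right_old p)"]
    by (metis length_rev rev_append rev_rev_ident)
  show ?thesis
    unfolding part_step_def using * x' y' by auto
qed

section \<open>The sweeping system of a machine\<close>

primrec opt_list :: "'a option \<Rightarrow> 'a list" where
  "opt_list None = []"
| "opt_list (Some a) = [a]"

fun first :: "'a list \<Rightarrow> 'a option" where
  "first [] = None"
| "first (a # _) = Some a"

lemma opt_list_first: "opt_list (first xs) = take 1 xs"
  by (cases xs) auto

lemma length_opt_list: "length (opt_list x) \<le> 1"
  by (cases x) auto

text \<open>
  A cell holds at most one letter of the input and at most one letter of each stack. Empty
  entries may occur anywhere: a list of cells stands for the stacks that remain when they
  are skipped, so that every list of cells stands for something.
\<close>

type_synonym 'a cell = "'a option \<times> (nat \<times> bool \<Rightarrow> 'a option)"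

definition content :: "nat \<times> bool \<Rightarrow> 'a cell list \<Rightarrow> 'a list" where
  "content j cs = concat (map (\<lambda>c. opt_list (snd c j)) cs)"

definition input :: "'a cell list \<Rightarrow> 'a list" where
  "input cs = concat (map (\<lambda>c. opt_list (fst c)) cs)"

lemma content_simps [simp]:
  "content j [] = []" "content j (c # cs) = opt_list (snd c j) @ content j cs"
  "content j (cs @ cs') = content j cs @ content j cs'"
  by (simp_all add: content_def)

lemma input_simps [simp]:
  "input [] = []" "input (c # cs) = opt_list (fst c) @ input cs"
  "input (cs @ cs') = input cs @ input cs'"
  by (simp_all add: input_def)

lemma length_content: "length (content j cs) \<le> length cs"
proof (induction cs)
  case (Cons c cs)
  then show ?case using length_opt_list[of "snd c j"] by simp
qed simp

lemma length_input: "length (input cs) \<le> length cs"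
proof (induction cs)
  case (Cons c cs)
  then show ?case using length_opt_list[of "fst c"] by simp
qed simp

text \<open>
  A head moving right carries, for each stack, a buffer of letters still to be put on top of
  it; it puts them there by shifting the stack through the buffer. A head moving left lifts
  the top letters of each stack into its buffers. The other two heads erase the work space
  before a new attempt, and delete the cells at the end.
\<close>

datatype ('a, 'q) head =
    Push "nat \<times> bool \<Rightarrow> 'a list" "'q list"
  | Pull "nat \<times> bool \<Rightarrow> 'a list" "'q list"
  | Restart
  | Halt

fun rightward :: "('a, 'q) head \<Rightarrow> bool" where
  "rightward (Push b qs) = True"
| "rightward Halt = True"
| "rightward (Pull b qs) = False"
| "rightward Restart = False"

definition push_buffer :: "(nat \<times> bool \<Rightarrow> 'a list) \<Rightarrow> 'a cell \<Rightarrow> nat \<times> bool \<Rightarrow> 'a list" where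
  "push_buffer b c j = drop 1 (b j @ opt_list (snd c j))"

definition push_cell :: "(nat \<times> bool \<Rightarrow> 'a list) \<Rightarrow> 'a cell \<Rightarrow> 'a cell" where
  "push_cell b c = (fst c, \<lambda>j. first (b j @ opt_list (snd c j)))"

definition pull_buffer ::
    "nat \<Rightarrow> (nat \<times> bool \<Rightarrow> 'a list) \<Rightarrow> 'a cell \<Rightarrow> nat \<times> bool \<Rightarrow> 'a list" where
  "pull_buffer K b c j = take K (opt_list (snd c j) @ b j)"

definition pull_cell :: "nat \<Rightarrow> (nat \<times> bool \<Rightarrow> 'a list) \<Rightarrow> 'a cell \<Rightarrow> 'a cell" where
  "pull_cell K b c = (fst c, \<lambda>j. first (drop K (opt_list (snd c j) @ b j)))"

text \<open>
  The initial configuration has its input on the left stack of tape \<open>0\<close>. As the top of that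
  stack is the last letter of the input, the input entries of the cells hold the input in
  reverse.
\<close>

definition reset_cell :: "'a cell \<Rightarrow> 'a cell" where
  "reset_cell c = (fst c, \<lambda>j. if j = (0, False) then fst c else None)"

definition blank_cell :: "'a cell" where
  "blank_cell = (None, \<lambda>_. None)"

text \<open>
  Commands may apply to the accepting configuration. The simulation stops there nevertheless:
  the space of a word is the minimum over its accepting and rejecting computations, and going on
  cannot take less space.
\<close>

definition halting :: "('a, 'q) tm \<Rightarrow> ('a, 'q) config \<Rightarrow> bool" where
  "halting M C \<longleftrightarrow> accept_config M C \<or> \<not> (\<exists>C'. tm_step M C C')"

text \<open>
  At the left end the head holds the tops of all stacks and the states of all heads of \<open>M\<close>.
  It regards them as a configuration of its own and performs a command on it.
\<close>

definition command_head ::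
    "('a, 'q) tm \<Rightarrow> (nat \<times> bool \<Rightarrow> 'a list) \<Rightarrow> 'q list \<Rightarrow> ('a, 'q) head" where
  "command_head M b qs =
     (let T = assemble (num_tapes M) b qs; T' = (SOME T'. tm_step M T T') in
      if halting M T then Halt else Push (stack T') (states T'))"

locale machine =
  fixes M :: "('a, 'q) tm"
  assumes tm: "turing_machine M" and det: "deterministic M"
begin

abbreviation k :: nat where "k \<equiv> num_tapes M"

text \<open>
  Larger than every word in a command, so that the top \<open>K\<close> letters of a stack decide whether
  a command applies, including the test that nothing else is on the stack.
\<close>

definition K :: nat where
  "K = Suc (\<Sum>\<theta>\<in>tm_commands M. \<Sum>p\<leftarrow>\<theta>.
     length (left_old p) + length (right_old p) + length (left_new p) + length (right_new p))"

definition Y :: "'a set" where "Y = (\<Union>i<k. tape_alphabet M i)"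

definition Q :: "'q set" where "Q = (\<Union>i<k. head_states M i)"

definition buffers :: "(nat \<times> bool \<Rightarrow> 'a list) set" where
  "buffers = {b. \<forall>j. (j \<in> {..<k} \<times> UNIV \<longrightarrow> b j \<in> {xs. set xs \<subseteq> Y \<and> length xs \<le> 2 * K}) \<and>
     (j \<notin> {..<k} \<times> UNIV \<longrightarrow> b j = [])}"

definition memories :: "((nat \<times> bool \<Rightarrow> 'a list) \<times> 'q list) set" where
  "memories = buffers \<times> {qs. set qs \<subseteq> Q \<and> length qs = k}"

definition cells :: "'a cell set" where
  "cells = insert None (Some ` input_alphabet M) \<times>
     {f. \<forall>j. (j \<in> {..<k} \<times> UNIV \<longrightarrow> f j \<in> insert None (Some ` Y)) \<and>
        (j \<notin> {..<k} \<times> UNIV \<longrightarrow> f j = None)}"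

text \<open>
  The right mark is where a lack of space shows: a buffer that is not empty there has found no
  cell for its letters.
\<close>

inductive_set rules ::
    "(('a cell, ('a, 'q) head) letter list \<times> ('a cell, ('a, 'q) head) letter list) set" where
  push: "(b, qs) \<in> memories \<Longrightarrow> c \<in> cells \<Longrightarrow>
    ([Head (Push b qs), RCell c],
     [LCell (push_cell b c), Head (Push (push_buffer b c) qs)]) \<in> rules"
| turn: "((\<lambda>_. []), qs) \<in> memories \<Longrightarrow>
    ([Head (Push (\<lambda>_. []) qs), RMark], [Head (Pull (\<lambda>_. []) qs), RMark]) \<in> rules"
| overflow: "(b, qs) \<in> memories \<Longrightarrow> b \<noteq> (\<lambda>_. []) \<Longrightarrow>
    ([Head (Push b qs), RMark], [Head Restart, RCell blank_cell, RMark]) \<in> rules"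
| pull: "(b, qs) \<in> memories \<Longrightarrow> c \<in> cells \<Longrightarrow>
    ([LCell c, Head (Pull b qs)],
     [Head (Pull (pull_buffer K b c) qs), RCell (pull_cell K b c)]) \<in> rules"
| command: "(b, qs) \<in> memories \<Longrightarrow>
    ([LMark, Head (Pull b qs)], [LMark, Head (command_head M b qs)]) \<in> rules"
| reset: "c \<in> cells \<Longrightarrow>
    ([LCell c, Head Restart], [Head Restart, RCell (reset_cell c)]) \<in> rules"
| start: "([LMark, Head Restart], [LMark, Head (Push (\<lambda>_. []) (start_states M))]) \<in> rules"
| erase: "c \<in> cells \<Longrightarrow> ([Head Halt, RCell c], [Head Halt]) \<in> rules"

lemma finite_alphabets: "finite Y" "finite Q" "finite (input_alphabet M)"
  using tm unfolding turing_machine_def Y_def Q_def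
  by (auto intro: finite_subset[of _ "tape_alphabet M 0"])

lemma finite_memories: "finite memories"
proof -
  have "finite buffers"
    unfolding buffers_def using finite_alphabets
    by (intro finite_set_of_finite_funs finite_lists_length_le) auto
  then show ?thesis
    unfolding memories_def using finite_alphabets by (simp add: finite_lists_length_eq)
qed

lemma finite_cells: "finite cells"
  unfolding cells_def using finite_alphabets
  by (intro finite_cartesian_product finite_set_of_finite_funs) auto

lemma finite_rules: "finite rules"
proof -
  let ?S =
    "(\<lambda>((b, qs), c). ([Head (Push b qs), RCell c],
        [LCell (push_cell b c), Head (Push (push_buffer b c) qs)])) ` (memories \<times> cells) \<union>
     (\<lambda>(b, qs). ([Head (Push b qs), RMark], [Head (Pull b qs), RMark])) ` memories \<union>
     (\<lambda>(b, qs). ([Head (Push b qs), RMark], [Head Restart, RCell blank_cell, RMark])) ` memories \<union>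
     (\<lambda>((b, qs), c). ([LCell c, Head (Pull b qs)],
        [Head (Pull (pull_buffer K b c) qs), RCell (pull_cell K b c)])) ` (memories \<times> cells) \<union>
     (\<lambda>(b, qs). ([LMark, Head (Pull b qs)], [LMark, Head (command_head M b qs)])) ` memories \<union>
     (\<lambda>c. ([LCell c, Head Restart], [Head Restart, RCell (reset_cell c)])) ` cells \<union>
     {([LMark, Head Restart], [LMark, Head (Push (\<lambda>_. []) (start_states M))])} \<union>
     (\<lambda>c. ([Head Halt, RCell c], [Head Halt])) ` cells"
  have "(l, r) \<in> ?S" if "(l, r) \<in> rules" for l r
    using that
  proof cases
    case (push b qs c)
    then show ?thesis by (intro UnI1) (rule image_eqI[of _ _ "((b, qs), c)"], auto)
  next
    case (turn qs)
    then have "(l, r) \<in> (\<lambda>(b, qs). ([Head (Push b qs), RMark], [Head (Pull b qs), RMark])) ` memories"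
      by (intro image_eqI[of _ _ "(\<lambda>_. [], qs)"]) auto
    then show ?thesis by blast
  next
    case (overflow b qs)
    then have "(l, r) \<in> (\<lambda>(b, qs). ([Head (Push b qs), RMark],
        [Head Restart, RCell blank_cell, RMark])) ` memories"
      by (intro image_eqI[of _ _ "(b, qs)"]) auto
    then show ?thesis by blast
  next
    case (pull b qs c)
    then have "(l, r) \<in> (\<lambda>((b, qs), c). ([LCell c, Head (Pull b qs)],
        [Head (Pull (pull_buffer K b c) qs), RCell (pull_cell K b c)])) ` (memories \<times> cells)"
      by (intro image_eqI[of _ _ "((b, qs), c)"]) auto
    then show ?thesis by blast
  next
    case (command b qs)
    then have "(l, r) \<in> (\<lambda>(b, qs). ([LMark, Head (Pull b qs)],
        [LMark, Head (command_head M b qs)])) ` memories"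
      by (intro image_eqI[of _ _ "(b, qs)"]) auto
    then show ?thesis by blast
  qed auto
  then have "rules \<subseteq> ?S" by (rule subrelI)
  moreover have "finite ?S" using finite_memories finite_cells by simp
  ultimately show ?thesis by (rule finite_subset)
qed

sublocale sweeping_system rules rightward
proof
  fix l r assume "(l, r) \<in> rules"
  then show "sweep_rule rightward l r"
  proof cases
    case (push b qs c)
    then show ?thesis
      using sweep_rule.right_cell[of rightward "Push b qs" c "[push_cell b c]"] by simp
  next
    case (turn qs)
    then show ?thesis using sweep_rule.right_mark[of rightward "Push (\<lambda>_. []) qs" _ "[]"] by simp
  next
    case (overflow b qs)
    then show ?thesis
      using sweep_rule.right_mark[of rightward "Push b qs" _ "[blank_cell]"] by simp
  next
    case (pull b qs c)
    then show ?thesis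
      using sweep_rule.left_cell[of rightward "Pull b qs" c _ "[pull_cell K b c]"] by simp
  next
    case (command b qs)
    then show ?thesis by (simp add: sweep_rule.left_mark)
  next
    case (reset c)
    then show ?thesis
      using sweep_rule.left_cell[of rightward Restart c _ "[reset_cell c]"] by simp
  next
    case start
    then show ?thesis by (simp add: sweep_rule.left_mark)
  next
    case (erase c)
    then show ?thesis using sweep_rule.right_cell[of rightward Halt c "[]"] by simp
  qed
next
  fix l r r' assume "(l, r) \<in> rules" "(l, r') \<in> rules"
  then show "r = r'" by cases (erule rules.cases; simp)+
qed

lemma command_part_bound:
  assumes "\<theta> \<in> tm_commands M" "p \<in> set \<theta>"
  shows "length (left_old p) + length (right_old p) + length (left_new p) + length (right_new p) < K"
proof -
  let ?f = "\<lambda>p :: ('a, 'q) command_part.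
    length (left_old p) + length (right_old p) + length (left_new p) + length (right_new p)"
  have "?f p \<le> (\<Sum>p\<leftarrow>\<theta>. ?f p)" using assms(2) by (intro member_le_sum_list) auto
  also have "\<dots> \<le> (\<Sum>\<theta>\<in>tm_commands M. \<Sum>p\<leftarrow>\<theta>. ?f p)"
    using assms(1) tm by (intro member_le_sum) (auto simp: turing_machine_def)
  finally show ?thesis by (simp add: K_def)
qed

lemma tm_step_deterministic:
  assumes "is_config M C" "tm_step M C C1" "tm_step M C C2"
  shows "C1 = C2"
proof -
  from assms obtain \<theta> where \<theta>: "command_step \<theta> C C1" "command_step \<theta> C C2"
    using det unfolding tm_step_def deterministic_def applicable_def by metis
  then have "C1 ! i = C2 ! i" if "i < length \<theta>" for i
    using that by (fastforce simp: command_step_def part_step_def)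
  with \<theta> show ?thesis by (intro nth_equalityI) (auto simp: command_step_def)
qed

lemma is_config_step:
  assumes "is_config M C" "tm_step M C C'"
  shows "is_config M C'"
proof -
  from assms(2) obtain \<theta> where \<theta>: "\<theta> \<in> tm_commands M" "command_step \<theta> C C'"
    by (auto simp: tm_step_def)
  then have len: "length \<theta> = k" "length C' = k"
    using tm by (auto simp: turing_machine_def command_step_def)
  have "C' ! i \<in> lists (tape_alphabet M i) \<times> head_states M i \<times> lists (tape_alphabet M i)"
    if i: "i < k" for i
  proof -
    have "wf_part (tape_alphabet M i) (head_states M i) (\<theta> ! i)"
      using tm \<theta>(1) i by (auto simp: turing_machine_def)
    moreover have "part_step (\<theta> ! i) (C ! i) (C' ! i)"
      using \<theta>(2) i len by (simp add: command_step_def)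
    moreover have "C ! i \<in> lists (tape_alphabet M i) \<times> head_states M i \<times> lists (tape_alphabet M i)"
      using assms(1) i by (simp add: is_config_def)
    ultimately show ?thesis by (auto simp: wf_part_def part_step_def)
  qed
  with len show ?thesis by (simp add: is_config_def)
qed

lemma is_config_stack:
  assumes "is_config M C"
  shows "set (stack C j) \<subseteq> Y"
proof (cases "fst j < k")
  case True
  obtain i r u q v where j: "j = (i, r)" "C ! i = (u, q, v)" by (metis prod_cases3 surj_pair)
  have "C ! i \<in> lists (tape_alphabet M i) \<times> head_states M i \<times> lists (tape_alphabet M i)"
    using assms True j(1) by (simp add: is_config_def)
  then have "set u \<subseteq> tape_alphabet M i" "set v \<subseteq> tape_alphabet M i" using j by auto
  with True j assms have "set (stack C j) \<subseteq> tape_alphabet M i"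
    by (simp add: stack_def is_config_def)
  with True j show ?thesis by (auto simp: Y_def)
next
  case False
  then show ?thesis using assms by (simp add: is_config_def stack_outside)
qed

lemma is_config_states:
  assumes "is_config M C"
  shows "set (states C) \<subseteq> Q" and "length (states C) = k"
proof -
  show len: "length (states C) = k" using assms by (simp add: is_config_def)
  have "states C ! i \<in> Q" if "i < k" for i
  proof -
    have "C ! i \<in> lists (tape_alphabet M i) \<times> head_states M i \<times> lists (tape_alphabet M i)"
      using assms that by (simp add: is_config_def)
    then show ?thesis
      using that len by (auto simp: states_def Q_def)
  qed
  with len show "set (states C) \<subseteq> Q" by (auto simp: in_set_conv_nth)
qed

text \<open>
  A command changes less than \<open>K\<close> letters on either side of a head, hence it cannot
  distinguish a configuration from the one that keeps only the top \<open>K\<close> letters of each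
  stack.
\<close>

lemma halting_truncate:
  fixes C :: "('a, 'q) config"
  assumes "is_config M C"
  defines "T \<equiv> assemble k (\<lambda>j. take K (stack C j)) (states C)"
  shows "accept_config M T = accept_config M C"
    and "tm_step M T T' \<Longrightarrow>
           tm_step M C (assemble k (\<lambda>j. stack T' j @ drop K (stack C j)) (states T'))"
    and "tm_step M C C' \<Longrightarrow> \<exists>T'. tm_step M T T'"
proof -
  have lenC: "length C = k" using assms(1) by (simp add: is_config_def)
  have T_stack: "stack T j = take K (stack C j)" for j
    by (cases j) (auto simp: T_def stack_assemble stack_outside lenC)
  have "K > 0" by (simp add: K_def)
  then show "accept_config M T = accept_config M C"
    using lenC unfolding accept_config_def eq_empty_config_iff T_stack
    by (simp add: T_def states_assemble)
  have split_tape: "\<exists>u q v. C ! i = (rev (drop K (rev u)) @ rev (take K (rev u)), q, take K v @ drop K v) \<and>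
      T ! i = (rev (take K (rev u)), q, take K v) \<and>
      stack C (i, False) = rev u \<and> stack C (i, True) = v" if "i < k" for i
    using that lenC
    by (cases "C ! i")
      (auto simp: T_def nth_assemble stack_def states_def simp flip: rev_append)
  show "tm_step M C (assemble k (\<lambda>j. stack T' j @ drop K (stack C j)) (states T'))"
    if "tm_step M T T'"
  proof -
    from that obtain \<theta> where \<theta>: "\<theta> \<in> tm_commands M" "command_step \<theta> T T'"
      by (auto simp: tm_step_def)
    then have len: "length \<theta> = k" "length T' = k"
      by (auto simp: command_step_def T_def)
    have "part_step (\<theta> ! i) (C ! i)
        (assemble k (\<lambda>j. stack T' j @ drop K (stack C j)) (states T') ! i)" if i: "i < k" for i
    proof -
      obtain u q v where uqv:
        "C ! i = (rev (drop K (rev u)) @ rev (take K (rev u)), q, take K v @ drop K v)"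
        "T ! i = (rev (take K (rev u)), q, take K v)"
        "stack C (i, False) = rev u" "stack C (i, True) = v"
        using split_tape[OF i] by blast
      obtain u' q' v' where T'i: "T' ! i = (u', q', v')" by (cases "T' ! i")
      have "part_step (\<theta> ! i) (T ! i) (T' ! i)"
        using \<theta>(2) i len by (simp add: command_step_def)
      then have "part_step (\<theta> ! i) (rev (take K (rev u)), q, take K v) (u', q', v')"
        unfolding uqv(2) T'i .
      moreover have "length (left_old (\<theta> ! i)) < K" "length (right_old (\<theta> ! i)) < K"
        using command_part_bound[OF \<theta>(1), of "\<theta> ! i"] i len by auto
      ultimately have "part_step (\<theta> ! i) (C ! i) (rev (drop K (rev u)) @ u', q', v' @ drop K v)"
        unfolding uqv(1) by (intro part_step_extend) auto
      then show ?thesis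
        using i len T'i uqv by (simp add: nth_assemble stack_def states_def)
    qed
    then have "command_step \<theta> C (assemble k (\<lambda>j. stack T' j @ drop K (stack C j)) (states T'))"
      using len lenC by (simp add: command_step_def)
    with \<theta>(1) show ?thesis by (auto simp: tm_step_def)
  qed
  show "\<exists>T'. tm_step M T T'" if "tm_step M C C'"
  proof -
    from that obtain \<theta> where \<theta>: "\<theta> \<in> tm_commands M" "command_step \<theta> C C'"
      by (auto simp: tm_step_def)
    then have len: "length \<theta> = k" "length T = k"
      using lenC by (auto simp: command_step_def T_def)
    have "\<exists>t. part_step (\<theta> ! i) (T ! i) t" if i: "i < k" for i
    proof -
      obtain u q v where uqv:
        "C ! i = (rev (drop K (rev u)) @ rev (take K (rev u)), q, take K v @ drop K v)"
        "T ! i = (rev (take K (rev u)), q, take K v)"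
        using split_tape[OF i] by blast
      have "part_step (\<theta> ! i) (C ! i) (C' ! i)"
        using \<theta>(2) i len by (simp add: command_step_def)
      note step = this[unfolded uqv(1)]
      have "length (left_old (\<theta> ! i)) < K" "length (right_old (\<theta> ! i)) < K"
        using command_part_bound[OF \<theta>(1), of "\<theta> ! i"] i len by auto
      then show ?thesis
        unfolding uqv(2) by (intro part_step_restrict[OF step]) auto
    qed
    then obtain t where t: "\<And>i. i < k \<Longrightarrow> part_step (\<theta> ! i) (T ! i) (t i)" by metis
    have "command_step \<theta> T (map t [0..<k])"
      using t len by (simp add: command_step_def)
    with \<theta>(1) show ?thesis by (auto simp: tm_step_def)
  qed
qed

lemma command_head_halting:
  assumes "is_config M C" "halting M C"
  shows "command_head M (\<lambda>j. take K (stack C j)) (states C) = Halt"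
  using assms(2) halting_truncate[OF assms(1)]
  unfolding command_head_def halting_def Let_def by metis

text \<open>
  The command that is chosen for the truncated configuration extends to the full one, where it
  has to be the command of \<open>M\<close> because \<open>M\<close> is deterministic.
\<close>

lemma command_head_step:
  assumes C: "is_config M C" and "\<not> halting M C" and step: "tm_step M C C'"
  obtains b where "command_head M (\<lambda>j. take K (stack C j)) (states C) = Push b (states C')"
    "(b, states C') \<in> memories" "\<And>j. b j @ drop K (stack C j) = stack C' j"
proof -
  define T where "T = assemble k (\<lambda>j. take K (stack C j)) (states C)"
  define T' where "T' = (SOME T'. tm_step M T T')"
  note truncate = halting_truncate[OF C, folded T_def]
  have "tm_step M T T'"
    unfolding T'_def using truncate(3)[OF step] by (rule someI_ex)
  then obtain \<theta> where \<theta>: "\<theta> \<in> tm_commands M" "command_step \<theta> T T'"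
    by (auto simp: tm_step_def)
  then have len: "length \<theta> = k" "length T' = k"
    by (auto simp: command_step_def T_def)
  have C'_eq: "C' = assemble k (\<lambda>j. stack T' j @ drop K (stack C j)) (states T')"
    using tm_step_deterministic[OF C step truncate(2)[OF \<open>tm_step M T T'\<close>]] .
  have lenC: "length C = k" using C by (simp add: is_config_def)
  have stacks: "stack T' j @ drop K (stack C j) = stack C' j" for j
    unfolding C'_eq using len lenC by (cases j) (auto simp: stack_assemble stack_outside)
  have states: "states C' = states T'"
    unfolding C'_eq using len by (simp add: states_assemble)
  have "length (stack T' (i, right)) \<le> 2 * K" if i: "i < k" for i right
  proof -
    have "part_step (\<theta> ! i) (T ! i) (T' ! i)"
      using \<theta>(2) i len by (simp add: command_step_def)
    moreover have "T ! i = (rev (take K (stack C (i, False))), states C ! i, take K (stack C (i, True)))"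
      using i by (simp add: T_def nth_assemble)
    ultimately obtain x y where
      x: "rev (take K (stack C (i, False))) = x @ left_old (\<theta> ! i)" and
      y: "take K (stack C (i, True)) = right_old (\<theta> ! i) @ y" and
      T'i: "T' ! i = (x @ left_new (\<theta> ! i), state_new (\<theta> ! i), right_new (\<theta> ! i) @ y)"
      by (auto simp: part_step_def)
    have "length x \<le> K" "length y \<le> K"
      using arg_cong[OF x, of length] arg_cong[OF y, of length] by auto
    moreover have "length (left_new (\<theta> ! i)) < K" "length (right_new (\<theta> ! i)) < K"
      using command_part_bound[OF \<theta>(1), of "\<theta> ! i"] i len by auto
    ultimately show ?thesis using T'i i len by (auto simp: stack_def)
  qed
  moreover have "set (stack T' j) \<subseteq> Y" for j
    using is_config_stack[OF is_config_step[OF C step], of j] stacks[of j]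
    by (metis Un_subset_iff set_append)
  moreover have "stack T' j = []" if "j \<notin> {..<k} \<times> UNIV" for j
    using that len by (cases j) (auto simp: stack_outside)
  ultimately have "stack T' \<in> buffers" by (auto simp: buffers_def)
  then have "(stack T', states C') \<in> memories"
    using is_config_states[OF is_config_step[OF C step]] by (simp add: memories_def)
  moreover have "\<not> halting M T"
    using assms(2) truncate(1) \<open>tm_step M T T'\<close> step by (auto simp: halting_def)
  then have "command_head M (\<lambda>j. take K (stack C j)) (states C) = Push (stack T') (states C')"
    by (simp add: command_head_def Let_def flip: T_def T'_def states)
  ultimately show ?thesis using that stacks by blast
qed

end

section \<open>Simulating a run\<close>

context machine
begin

lemma buffersD:
  assumes "(b, qs) \<in> memories"
  shows "set (b j) \<subseteq> Y" "length (b j) \<le> 2 * K" "j \<notin> {..<k} \<times> UNIV \<Longrightarrow> b j = []"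
proof -
  have "(j \<in> {..<k} \<times> UNIV \<longrightarrow> b j \<in> {xs. set xs \<subseteq> Y \<and> length xs \<le> 2 * K}) \<and>
      (j \<notin> {..<k} \<times> UNIV \<longrightarrow> b j = [])"
    using assms unfolding memories_def buffers_def by blast
  then show "set (b j) \<subseteq> Y" "length (b j) \<le> 2 * K" "j \<notin> {..<k} \<times> UNIV \<Longrightarrow> b j = []"
    by (cases "j \<in> {..<k} \<times> UNIV"; simp)+
qed

lemma memoriesI:
  assumes "(b, qs) \<in> memories"
    and "\<And>j. set (b' j) \<subseteq> Y" "\<And>j. length (b' j) \<le> 2 * K"
      "\<And>j. j \<notin> {..<k} \<times> UNIV \<Longrightarrow> b' j = []"
  shows "(b', qs) \<in> memories"
  using assms unfolding memories_def buffers_def by blast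

lemma cellsD:
  assumes "c \<in> cells"
  shows "set (opt_list (fst c)) \<subseteq> input_alphabet M" "set (opt_list (snd c j)) \<subseteq> Y"
    "j \<notin> {..<k} \<times> UNIV \<Longrightarrow> snd c j = None"
proof -
  have "fst c \<in> insert None (Some ` input_alphabet M)"
    using assms unfolding cells_def mem_Times_iff[of c] by (rule conjunct1)
  then show "set (opt_list (fst c)) \<subseteq> input_alphabet M" by (cases "fst c") auto
  have *: "(j \<in> {..<k} \<times> UNIV \<longrightarrow> snd c j \<in> insert None (Some ` Y)) \<and>
      (j \<notin> {..<k} \<times> UNIV \<longrightarrow> snd c j = None)" for j
    using conjunct2[OF assms[unfolded cells_def mem_Times_iff[of c] mem_Collect_eq]] by (rule spec)
  show "set (opt_list (snd c j)) \<subseteq> Y" using *[of j] by (cases "snd c j") auto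
  show "j \<notin> {..<k} \<times> UNIV \<Longrightarrow> snd c j = None" using *[of j] by blast
qed

lemma cellsI:
  assumes "c \<in> cells" "\<And>j. set (xs j) \<subseteq> Y" "\<And>j. j \<notin> {..<k} \<times> UNIV \<Longrightarrow> xs j = []"
  shows "(fst c, \<lambda>j. first (xs j)) \<in> cells"
proof -
  have "first (xs j) \<in> insert None (Some ` Y)" for j
    using assms(2)[of j] by (cases "xs j") auto
  moreover have "first (xs j) = None" if "j \<notin> {..<k} \<times> UNIV" for j
    using assms(3)[OF that] by simp
  moreover have "fst c \<in> insert None (Some ` input_alphabet M)"
    using assms(1) unfolding cells_def mem_Times_iff[of c] by (rule conjunct1)
  ultimately show ?thesis by (auto simp: cells_def)
qed

lemma push_closed:
  assumes "(b, qs) \<in> memories" "c \<in> cells"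
  shows "(push_buffer b c, qs) \<in> memories" "push_cell b c \<in> cells"
proof -
  have *: "set (b j @ opt_list (snd c j)) \<subseteq> Y" for j
    using buffersD(1)[OF assms(1), of j] cellsD(2)[OF assms(2), of j] by simp
  have **: "b j @ opt_list (snd c j) = []" if "j \<notin> {..<k} \<times> UNIV" for j
    using buffersD(3)[OF assms(1) that] cellsD(3)[OF assms(2) that] by simp
  show "(push_buffer b c, qs) \<in> memories"
  proof (rule memoriesI[OF assms(1)])
    fix j
    show "set (push_buffer b c j) \<subseteq> Y"
      unfolding push_buffer_def by (rule order_trans[OF set_drop_subset *])
    show "length (push_buffer b c j) \<le> 2 * K"
      using buffersD(2)[OF assms(1), of j] length_opt_list[of "snd c j"]
      by (simp add: push_buffer_def)
    show "push_buffer b c j = []" if "j \<notin> {..<k} \<times> UNIV"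
      unfolding push_buffer_def **[OF that] by simp
  qed
  show "push_cell b c \<in> cells"
    unfolding push_cell_def
    by (rule cellsI[of c "\<lambda>j. b j @ opt_list (snd c j)", OF assms(2) * **])
qed

lemma pull_closed:
  assumes "(b, qs) \<in> memories" "c \<in> cells"
  shows "(pull_buffer K b c, qs) \<in> memories" "pull_cell K b c \<in> cells"
proof -
  have *: "set (opt_list (snd c j) @ b j) \<subseteq> Y" for j
    using buffersD(1)[OF assms(1), of j] cellsD(2)[OF assms(2), of j] by simp
  have **: "opt_list (snd c j) @ b j = []" if "j \<notin> {..<k} \<times> UNIV" for j
    using buffersD(3)[OF assms(1) that] cellsD(3)[OF assms(2) that] by simp
  show "(pull_buffer K b c, qs) \<in> memories"
  proof (rule memoriesI[OF assms(1)])
    fix j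
    show "set (pull_buffer K b c j) \<subseteq> Y"
      unfolding pull_buffer_def by (rule order_trans[OF set_take_subset *])
    show "length (pull_buffer K b c j) \<le> 2 * K"
      by (simp add: pull_buffer_def)
    show "pull_buffer K b c j = []" if "j \<notin> {..<k} \<times> UNIV"
      unfolding pull_buffer_def **[OF that] by simp
  qed
  have 1: "set (drop K (opt_list (snd c j) @ b j)) \<subseteq> Y" for j
    by (rule order_trans[OF set_drop_subset *])
  have 2: "drop K (opt_list (snd c j) @ b j) = []" if "j \<notin> {..<k} \<times> UNIV" for j
    unfolding **[OF that] by simp
  show "pull_cell K b c \<in> cells"
    unfolding pull_cell_def
    by (rule cellsI[of c "\<lambda>j. drop K (opt_list (snd c j) @ b j)", OF assms(2) 1 2])
qed

lemma reset_closed: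
  assumes "c \<in> cells"
  shows "reset_cell c \<in> cells"
proof -
  define f where "f j = (if j = (0, False) then opt_list (fst c) else [])" for j :: "nat \<times> bool"
  have k: "0 < k" and "input_alphabet M \<subseteq> tape_alphabet M 0"
    using tm by (simp_all add: turing_machine_def)
  then have "input_alphabet M \<subseteq> Y" unfolding Y_def by blast
  then have "set (f j) \<subseteq> Y" for j
    using cellsD(1)[OF assms] by (cases "j = (0, False)") (simp_all add: f_def)
  moreover have "f j = []" if "j \<notin> {..<k} \<times> UNIV" for j
    using that k by (cases "j = (0, False)") (simp_all add: f_def)
  ultimately have "(fst c, \<lambda>j. first (f j)) \<in> cells" by (rule cellsI[OF assms])
  moreover have "(\<lambda>j. first (f j)) = snd (reset_cell c)"
    by (rule ext, cases "fst c") (simp_all add: f_def reset_cell_def)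
  ultimately show ?thesis by (simp add: reset_cell_def)
qed

lemma blank_closed: "blank_cell \<in> cells"
  by (simp add: blank_cell_def cells_def)

lemma reset_blank: "reset_cell blank_cell = blank_cell"
  by (auto simp: reset_cell_def blank_cell_def)

text \<open>
  In each cell the buffer takes up at most one letter and, unless it is empty, gives off one. So
  if letters are left in the end, it has filled every cell.
\<close>

lemma push_sweep:
  assumes "(b, qs) \<in> memories" "cs \<in> lists cells"
    and "length pre + length cs + 1 + length post \<le> B"
  shows "\<exists>b' cs'. (b', qs) \<in> memories \<and> cs' \<in> lists cells \<and> length cs' = length cs \<and>
     input cs' = input cs \<and> (\<forall>j. content j cs' @ b' j = b j @ content j cs) \<and>
     (\<forall>j. b' j \<noteq> [] \<longrightarrow> length (content j cs') = length cs) \<and>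
     reaches B (pre @ Head (Push b qs) # map RCell cs @ post)
       (pre @ map LCell cs' @ Head (Push b' qs) # post)"
  using assms
proof (induction cs arbitrary: b pre)
  case Nil
  then show ?case by (intro exI[of _ b] exI[of _ "[]"]) (simp add: reaches_refl)
next
  case (Cons c cs)
  let ?b = "push_buffer b c" and ?c = "push_cell b c"
  have c: "c \<in> cells" "cs \<in> lists cells" using Cons.prems by auto
  note closed = push_closed[OF Cons.prems(1) c(1)]
  obtain b' cs' where IH: "(b', qs) \<in> memories" "cs' \<in> lists cells" "length cs' = length cs"
    "input cs' = input cs" "\<And>j. content j cs' @ b' j = ?b j @ content j cs"
    "\<And>j. b' j \<noteq> [] \<Longrightarrow> length (content j cs') = length cs"
    "reaches B ((pre @ [LCell ?c]) @ Head (Push ?b qs) # map RCell cs @ post)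
       ((pre @ [LCell ?c]) @ map LCell cs' @ Head (Push b' qs) # post)"
    using Cons.IH[OF closed(1) c(2), of "pre @ [LCell ?c]"] Cons.prems(3) by auto
  have "reaches B (pre @ [Head (Push b qs), RCell c] @ map RCell cs @ post)
      (pre @ [LCell ?c, Head (Push ?b qs)] @ map RCell cs @ post)"
    using Cons.prems by (intro reaches_step rules.push c(1)) auto
  then have "reaches B (pre @ Head (Push b qs) # map RCell (c # cs) @ post)
      (pre @ map LCell (?c # cs') @ Head (Push b' qs) # post)"
    using IH(7) by (auto intro: reaches_trans)
  moreover have "content j (?c # cs') @ b' j = b j @ content j (c # cs)" for j
  proof -
    have "content j (?c # cs') @ b' j =
        take 1 (b j @ opt_list (snd c j)) @ drop 1 (b j @ opt_list (snd c j)) @ content j cs"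
      using IH(5)[of j] by (simp add: push_cell_def opt_list_first push_buffer_def)
    then show ?thesis by (simp only: append_take_drop_id append.assoc[symmetric]) simp
  qed
  moreover have "length (content j (?c # cs')) = length (c # cs)" if "b' j \<noteq> []" for j
  proof -
    \<comment> \<open>A buffer never grows during the sweep, so it was not empty at \<open>c\<close> either.\<close>
    have "length (?b j) + length (content j cs) > length cs"
      using IH(5)[of j] IH(6)[OF that] that
      by (metis length_append length_greater_0_conv less_add_same_cancel1)
    then have "?b j \<noteq> []" using length_content[of j cs] by (cases "?b j") auto
    then have "1 < length (b j @ opt_list (snd c j))" by (auto simp: push_buffer_def)
    then have "length (take 1 (b j @ opt_list (snd c j))) = 1" by (simp only: length_take min_def) simp
    then have "length (opt_list (snd ?c j)) = 1"
      by (simp only: push_cell_def opt_list_first snd_conv)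
    then show ?thesis using IH(6)[OF that] by simp
  qed
  ultimately show ?case
    using IH(1-4) closed(2) by (intro exI[of _ b'] exI[of _ "?c # cs'"]) (simp add: push_cell_def)
qed

lemma pull_sweep:
  assumes "(b, qs) \<in> memories" "cs \<in> lists cells" "\<And>j. length (b j) \<le> K"
    and "length pre + length cs + 1 + length post \<le> B"
  shows "\<exists>b' cs'. (b', qs) \<in> memories \<and> cs' \<in> lists cells \<and> length cs' = length cs \<and>
     input cs' = input cs \<and> (\<forall>j. b' j = take K (content j cs @ b j)) \<and>
     (\<forall>j. content j cs' = drop K (content j cs @ b j)) \<and>
     reaches B (pre @ map LCell cs @ Head (Pull b qs) # post)
       (pre @ Head (Pull b' qs) # map RCell cs' @ post)"
  using assms
proof (induction cs arbitrary: b post rule: rev_induct)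
  case Nil
  then show ?case by (intro exI[of _ b] exI[of _ "[]"]) (simp add: reaches_refl)
next
  case (snoc c cs)
  let ?b = "pull_buffer K b c" and ?c = "pull_cell K b c"
  have c: "c \<in> cells" "cs \<in> lists cells" using snoc.prems by auto
  note closed = pull_closed[OF snoc.prems(1) c(1)]
  have "length (?b j) \<le> K" for j by (simp add: pull_buffer_def)
  then obtain b' cs' where IH: "(b', qs) \<in> memories" "cs' \<in> lists cells" "length cs' = length cs"
    "input cs' = input cs" "\<And>j. b' j = take K (content j cs @ ?b j)"
    "\<And>j. content j cs' = drop K (content j cs @ ?b j)"
    "reaches B (pre @ map LCell cs @ Head (Pull ?b qs) # RCell ?c # post)
       (pre @ Head (Pull b' qs) # map RCell cs' @ RCell ?c # post)"
    using snoc.IH[OF closed(1) c(2), of "RCell ?c # post"] snoc.prems(4) by auto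
  have "reaches B ((pre @ map LCell cs) @ [LCell c, Head (Pull b qs)] @ post)
      ((pre @ map LCell cs) @ [Head (Pull ?b qs), RCell ?c] @ post)"
    using snoc.prems by (intro reaches_step rules.pull c(1)) auto
  then have path: "reaches B (pre @ map LCell (cs @ [c]) @ Head (Pull b qs) # post)
      (pre @ Head (Pull b' qs) # map RCell (cs' @ [?c]) @ post)"
    using IH(7) by (auto intro: reaches_trans)
  have buffer: "b' j = take K (content j (cs @ [c]) @ b j)" for j
    unfolding IH(5) by (simp add: pull_buffer_def min_def)
  have content: "content j (cs' @ [?c]) = drop K (content j (cs @ [c]) @ b j)" for j
  proof -
    let ?x = "opt_list (snd c j) @ b j"
    have "length (drop K ?x) \<le> 1"
      using snoc.prems(3)[of j] length_opt_list[of "snd c j"] by simp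
    then have "opt_list (snd ?c j) = drop K ?x"
      by (simp add: pull_cell_def opt_list_first)
    moreover have "drop K (content j cs @ take K ?x) @ drop K ?x = drop K (content j cs @ ?x)"
    proof (cases "length ?x \<le> K")
      case False
      \<comment> \<open>A full buffer alone already fills the first \<open>K\<close> places.\<close>
      have "drop K (content j cs @ take K ?x) @ drop K ?x =
          drop K ((content j cs @ take K ?x) @ drop K ?x)"
        using False by simp
      also have "\<dots> = drop K (content j cs @ ?x)"
        by (simp only: append.assoc append_take_drop_id)
      finally show ?thesis .
    qed simp
    ultimately show ?thesis by (simp add: IH(6) pull_buffer_def)
  qed
  show ?case
  proof (intro exI conjI allI)
    show "length (cs' @ [?c]) = length (cs @ [c])" "input (cs' @ [?c]) = input (cs @ [c])"
      using IH(3,4) by (simp_all add: pull_cell_def)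
    show "cs' @ [?c] \<in> lists cells" using IH(2) closed(2) by simp
  qed (rule IH(1) buffer content path)+
qed

lemma restart_sweep:
  assumes "length pre + length cs + 1 + length post \<le> B" "cs \<in> lists cells"
  shows "reaches B (pre @ map LCell cs @ Head Restart # post)
    (pre @ Head Restart # map RCell (map reset_cell cs) @ post)"
  using assms
proof (induction cs arbitrary: post rule: rev_induct)
  case (snoc c cs)
  have c: "c \<in> cells" and cs: "cs \<in> lists cells" using snoc.prems(2) by auto
  have "reaches B ((pre @ map LCell cs) @ [LCell c, Head Restart] @ post)
      ((pre @ map LCell cs) @ [Head Restart, RCell (reset_cell c)] @ post)"
    using snoc.prems(1) by (intro reaches_step rules.reset c) auto
  moreover have "reaches B (pre @ map LCell cs @ Head Restart # RCell (reset_cell c) # post)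
    (pre @ Head Restart # map RCell (map reset_cell cs) @ RCell (reset_cell c) # post)"
    using snoc.prems(1) by (intro snoc.IH cs) auto
  ultimately show ?case by (auto intro: reaches_trans)
qed (simp add: reaches_refl)

lemma erase_sweep:
  assumes "length pre + length cs + 1 + length post \<le> B" "cs \<in> lists cells"
  shows "reaches B (pre @ Head Halt # map RCell cs @ post) (pre @ Head Halt # post)"
  using assms
proof (induction cs)
  case (Cons c cs)
  have c: "c \<in> cells" and cs: "cs \<in> lists cells" using Cons.prems(2) by auto
  have "reaches B (pre @ [Head Halt, RCell c] @ map RCell cs @ post)
      (pre @ [Head Halt] @ map RCell cs @ post)"
    using Cons.prems(1) by (intro reaches_step rules.erase c) auto
  moreover have "reaches B (pre @ Head Halt # map RCell cs @ post) (pre @ Head Halt # post)"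
    using Cons.prems(1) by (intro Cons.IH cs) auto
  ultimately show ?case by (auto intro: reaches_trans)
qed (simp add: reaches_refl)

text \<open>
  The configuration in front of a right sweep, which is still to bring the buffered letters into
  the cells.
\<close>

definition represents ::
    "('a, 'q) config \<Rightarrow> (nat \<times> bool \<Rightarrow> 'a list) \<Rightarrow> 'q list \<Rightarrow> 'a cell list \<Rightarrow> bool" where
  "represents C b qs cs \<longleftrightarrow> (b, qs) \<in> memories \<and> cs \<in> lists cells \<and> qs = states C \<and>
     (\<forall>j. b j @ content j cs = stack C j)"

abbreviation left_word ::
    "('a, 'q) head \<Rightarrow> 'a cell list \<Rightarrow> ('a cell, ('a, 'q) head) letter list" where
  "left_word s cs \<equiv> LMark # Head s # map RCell cs @ [RMark]"

abbreviation overflow_word :: "'a cell list \<Rightarrow> ('a cell, ('a, 'q) head) letter list" where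
  "overflow_word cs \<equiv> LMark # map LCell cs @ [Head Restart, RCell blank_cell, RMark]"

text \<open>
  An overflow witnesses a stack with more letters than there are cells. Otherwise every stack
  fits into the cells, which bounds the space of the configuration in terms of their number.
\<close>

lemma one_cycle:
  assumes "is_config M C" "represents C b qs cs" "length cs + 4 \<le> B"
  obtains (overflow) cs' where "cs' \<in> lists cells" "length cs' = length cs" "input cs' = input cs"
      "length cs < config_space C" "reaches B (left_word (Push b qs) cs) (overflow_word cs')"
  | (fits) cs' where "cs' \<in> lists cells" "length cs' = length cs" "input cs' = input cs"
      "config_space C \<le> 2 * k * length cs" "\<And>j. content j cs' = drop K (stack C j)"
      "reaches B (left_word (Push b qs) cs)
         (left_word (command_head M (\<lambda>j. take K (stack C j)) (states C)) cs')"
proof -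
  have rep: "(b, qs) \<in> memories" "cs \<in> lists cells" "qs = states C"
    "\<And>j. b j @ content j cs = stack C j"
    using assms(2) by (auto simp: represents_def)
  obtain b1 cs1 where 1: "(b1, qs) \<in> memories" "cs1 \<in> lists cells" "length cs1 = length cs"
     "input cs1 = input cs" "\<And>j. content j cs1 @ b1 j = stack C j"
     "\<And>j. b1 j \<noteq> [] \<Longrightarrow> length (content j cs1) = length cs"
     "reaches B ([LMark] @ Head (Push b qs) # map RCell cs @ [RMark])
       ([LMark] @ map LCell cs1 @ Head (Push b1 qs) # [RMark])"
    using push_sweep[OF rep(1,2), of "[LMark]" "[RMark]" B] assms(3) rep(4) by auto
  show ?thesis
  proof (cases "b1 = (\<lambda>_. [])")
    case False
    then obtain j where j: "b1 j \<noteq> []" unfolding fun_eq_iff by blast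
    then have "length cs < length (stack C j)"
      using 1(5)[of j] 1(6)[OF j] by (metis length_append length_greater_0_conv less_add_same_cancel1)
    then have "length cs < config_space C" using length_stack_le_config_space order.strict_trans2 by blast
    moreover have "reaches B ((LMark # map LCell cs1) @ [Head (Push b1 qs), RMark] @ [])
        ((LMark # map LCell cs1) @ [Head Restart, RCell blank_cell, RMark] @ [])"
      using assms(3) 1(3) False by (intro reaches_step rules.overflow 1(1)) auto
    then have "reaches B (left_word (Push b qs) cs) (overflow_word cs1)"
      using 1(7) by (auto intro: reaches_trans)
    ultimately show ?thesis using overflow 1 by blast
  next
    case True
    then have content1: "content j cs1 = stack C j" for j using 1(5)[of j] by simp
    then have "length (stack C j) \<le> length cs" for j using length_content[of j cs1] 1(3) by simp
    then have "config_space C \<le> 2 * k * length cs"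
      using config_space_le[of C "length cs"] assms(1) by (simp add: is_config_def)
    moreover
    have mem: "((\<lambda>_. []), qs) \<in> memories" using 1(1) True by simp
    have "reaches B ((LMark # map LCell cs1) @ [Head (Push (\<lambda>_. []) qs), RMark] @ [])
        ((LMark # map LCell cs1) @ [Head (Pull (\<lambda>_. []) qs), RMark] @ [])"
      using assms(3) 1(3) by (intro reaches_step rules.turn mem) auto
    then have r1: "reaches B (left_word (Push b qs) cs)
        ([LMark] @ map LCell cs1 @ Head (Pull (\<lambda>_. []) qs) # [RMark])"
      using 1(7) True by (auto intro: reaches_trans)
    obtain b2 cs2 where 2: "(b2, qs) \<in> memories" "cs2 \<in> lists cells" "length cs2 = length cs"
      "input cs2 = input cs" "\<And>j. b2 j = take K (stack C j)"
      "\<And>j. content j cs2 = drop K (stack C j)"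
      "reaches B ([LMark] @ map LCell cs1 @ Head (Pull (\<lambda>_. []) qs) # [RMark])
         ([LMark] @ Head (Pull b2 qs) # map RCell cs2 @ [RMark])"
      using pull_sweep[OF mem 1(2), of "[LMark]" "[RMark]" B] assms(3) 1(3,4) content1 by auto
    have b2: "b2 = (\<lambda>j. take K (stack C j))" using 2(5) by auto
    have "reaches B ([] @ [LMark, Head (Pull b2 qs)] @ map RCell cs2 @ [RMark])
        ([] @ [LMark, Head (command_head M b2 qs)] @ map RCell cs2 @ [RMark])"
      using assms(3) 2(3) by (intro reaches_step rules.command 2(1)) auto
    then have "reaches B (left_word (Push b qs) cs)
         (left_word (command_head M (\<lambda>j. take K (stack C j)) (states C)) cs2)"
      using reaches_trans[OF r1 2(7)] b2 rep(3) by (auto intro: reaches_trans)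
    ultimately show ?thesis using fits 2 by blast
  qed
qed

abbreviation run :: "('a, 'q) config list \<Rightarrow> bool" where
  "run Cs \<equiv> successively (\<lambda>C C'. tm_step M C C' \<and> \<not> halting M C) Cs \<and> halting M (last Cs)"

lemma simulate_run:
  assumes "run (C # Cs)" "is_config M C" "represents C b qs cs" "length cs + 4 \<le> B"
  shows "(\<exists>cs'. cs' \<in> lists cells \<and> length cs' = length cs \<and> input cs' = input cs \<and>
            (\<exists>D\<in>set (C # Cs). length cs < config_space D) \<and>
            reaches B (left_word (Push b qs) cs) (overflow_word cs')) \<or>
         (\<exists>cs'. cs' \<in> lists cells \<and> length cs' = length cs \<and> (\<forall>D\<in>set (C # Cs). config_space D \<le> 2 * k * length cs') \<and>
            reaches B (left_word (Push b qs) cs) (left_word Halt cs'))"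
  using assms
proof (induction Cs arbitrary: C b qs cs)
  case Nil
  from Nil.prems(2,3,4) show ?case
  proof (cases rule: one_cycle)
    case (fits cs')
    then show ?thesis
      using command_head_halting[OF Nil.prems(2)] Nil.prems(1) by auto
  qed auto
next
  case (Cons D Cs)
  from Cons.prems(2,3,4) show ?case
  proof (cases rule: one_cycle)
    case (fits cs')
    have step: "tm_step M C D" "\<not> halting M C" and run: "run (D # Cs)" using Cons.prems(1) by auto
    obtain b' where b': "command_head M (\<lambda>j. take K (stack C j)) (states C) = Push b' (states D)"
      "(b', states D) \<in> memories" "\<And>j. b' j @ drop K (stack C j) = stack D j"
      using command_head_step[OF Cons.prems(2) step(2,1)] by blast
    have "represents D b' (states D) cs'"
      using b' fits by (simp add: represents_def)
    from Cons.IH[OF run is_config_step[OF Cons.prems(2) step(1)] this] fits(2) Cons.prems(4)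
    have IH: "(\<exists>ds. ds \<in> lists cells \<and> length ds = length cs' \<and> input ds = input cs' \<and>
            (\<exists>E\<in>set (D # Cs). length cs' < config_space E) \<and>
            reaches B (left_word (Push b' (states D)) cs') (overflow_word ds)) \<or>
         (\<exists>ds. ds \<in> lists cells \<and> length ds = length cs' \<and>
            (\<forall>E\<in>set (D # Cs). config_space E \<le> 2 * k * length ds) \<and>
            reaches B (left_word (Push b' (states D)) cs') (left_word Halt ds))"
      by simp
    note path = reaches_trans[OF fits(6)[unfolded b'(1)]]
    from IH show ?thesis
    proof (elim disjE exE conjE)
      fix ds assume "ds \<in> lists cells" "length ds = length cs'" "input ds = input cs'"
        "\<exists>E\<in>set (D # Cs). length cs' < config_space E"
        "reaches B (left_word (Push b' (states D)) cs') (overflow_word ds)"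
      then show ?thesis
        using fits(2,3) path by (intro disjI1 exI[of _ ds]) auto
    next
      fix ds assume "ds \<in> lists cells" "length ds = length cs'"
        "\<forall>E\<in>set (D # Cs). config_space E \<le> 2 * k * length ds"
        "reaches B (left_word (Push b' (states D)) cs') (left_word Halt ds)"
      then show ?thesis
        using fits(2,4) path by (intro disjI2 exI[of _ ds]) auto
    qed
  qed auto
qed

end

section \<open>Restarting with more space\<close>

context machine
begin

lemma is_config_input:
  assumes "u \<in> lists (input_alphabet M)"
  shows "is_config M (input_config M u)"
proof -
  have "u \<in> lists (tape_alphabet M 0)"
    using assms tm lists_mono[of "input_alphabet M" "tape_alphabet M 0"]
    by (auto simp: turing_machine_def)
  then show ?thesis
    using tm by (auto simp: is_config_def input_config_def turing_machine_def state_vector_def)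
qed

lemma represents_input:
  assumes cs: "cs \<in> lists cells"
  shows "rev (input cs) \<in> lists (input_alphabet M)"
    and "represents (input_config M (rev (input cs))) (\<lambda>_. []) (start_states M) (map reset_cell cs)"
proof -
  have "input cs \<in> lists (input_alphabet M)"
    using cs
  proof (induction cs)
    case (Cons c cs)
    then have "set (opt_list (fst c)) \<subseteq> input_alphabet M" by (intro cellsD) auto
    with Cons show ?case by auto
  qed simp
  then show u: "rev (input cs) \<in> lists (input_alphabet M)" by (simp add: in_lists_conv_set)
  let ?C = "input_config M (rev (input cs))"
  have start: "length (start_states M) = k"
    using tm by (simp add: turing_machine_def state_vector_def)
  have states: "states ?C = start_states M"
    by (rule nth_equalityI) (simp_all add: states_def input_config_def start)
  have "((\<lambda>_. []), start_states M) \<in> memories"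
    using is_config_states[OF is_config_input[OF u]] unfolding states
    by (simp add: memories_def buffers_def)
  moreover have "map reset_cell cs \<in> lists cells" using cs reset_closed by auto
  moreover have "content j (map reset_cell cs) = stack ?C j" for j
  proof -
    have "content j (map reset_cell cs) = (if j = (0, False) then input cs else [])"
      by (induction cs) (auto simp: reset_cell_def)
    moreover have "stack ?C j = (if j = (0, False) then input cs else [])"
      using tm by (cases j) (auto simp: stack_def input_config_def turing_machine_def)
    ultimately show ?thesis by simp
  qed
  ultimately show "represents ?C (\<lambda>_. []) (start_states M) (map reset_cell cs)"
    by (simp add: represents_def states)
qed

text \<open>
  Cut a computation of minimal space at its first halting configuration. What remains still
  accepts or rejects: if its last configuration does not accept, then it has no successor and
  nothing was cut off.
\<close>

lemma obtain_run:
  assumes "accepts M u \<or> rejects M u"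
  obtains Cs where "run (input_config M u # Cs)"
    "\<And>D. D \<in> set (input_config M u # Cs) \<Longrightarrow> config_space D \<le> word_space M u"
    "\<exists>D\<in>set (input_config M u # Cs). word_space M u \<le> config_space D"
proof -
  let ?halts = "\<lambda>Cs. accepting_computation M u Cs \<or> rejecting_computation M u Cs"
  have "\<exists>s Es. ?halts Es \<and> computation_space Es = s"
    using assms by (auto simp: accepts_def rejects_def)
  from LeastI_ex[OF this] obtain Es where Es: "?halts Es" "computation_space Es = word_space M u"
    unfolding word_space_def by blast
  then have comp: "Es \<noteq> []" "hd Es = input_config M u" "successively (tm_step M) Es"
    by (auto simp: accepting_computation_def rejecting_computation_def computation_def)
  define n where "n = (LEAST i. i < length Es \<and> halting M (Es ! i))"
  have "halting M (last Es)"
    using Es(1) by (auto simp: accepting_computation_def rejecting_computation_def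
      reject_config_def halting_def)
  then have ex: "\<exists>i. i < length Es \<and> halting M (Es ! i)"
    using comp(1) by (intro exI[of _ "length Es - 1"]) (simp add: last_conv_nth)
  from LeastI_ex[OF ex] have n: "n < length Es" "halting M (Es ! n)" unfolding n_def by blast+
  have before: "\<not> halting M (Es ! i)" if "i < n" for i
    using not_less_Least[of i "\<lambda>i. i < length Es \<and> halting M (Es ! i)"] that n(1)
    unfolding n_def[symmetric] by auto
  define Cs where "Cs = take (Suc n) Es"
  have len: "length Cs = Suc n" using n(1) by (simp add: Cs_def)
  have nth: "Cs ! i = Es ! i" if "i \<le> n" for i using that by (simp add: Cs_def)
  have last: "last Cs = Es ! n"
    using len nth[of n] by (metis diff_Suc_1 last_conv_nth length_0_conv nat.simps(3) order_refl)
  have succ: "tm_step M (Es ! i) (Es ! Suc i)" if "Suc i < length Es" for i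
    using comp(3) that by (auto simp: successively_conv_nth)
  have "run Cs"
    using len nth last n before succ by (auto simp: successively_conv_nth)
  have comp': "computation M u Cs"
    using len nth comp n(1) succ
    by (auto simp: computation_def successively_conv_nth hd_conv_nth Cs_def)
  have "?halts Cs"
  proof (cases "accept_config M (Es ! n)")
    case True
    then show ?thesis using comp' last by (simp add: accepting_computation_def)
  next
    case False
    then have "\<not> tm_step M (Es ! n) C" for C using n(2) by (auto simp: halting_def)
    then have "\<not> Suc n < length Es" using succ by blast
    then have "Cs = Es" by (simp add: Cs_def)
    then show ?thesis using Es by simp
  qed
  then have "word_space M u \<le> computation_space Cs"
    unfolding word_space_def by (intro Least_le) blast
  moreover have "computation_space Cs \<in> config_space ` set Cs"
    unfolding computation_space_def using len by (intro Max_in) auto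
  ultimately have ge: "\<exists>D\<in>set Cs. word_space M u \<le> config_space D" by auto
  have le: "config_space D \<le> word_space M u" if "D \<in> set Cs" for D
  proof -
    have "D \<in> set Es" using that unfolding Cs_def by (rule in_set_takeD)
    then show ?thesis unfolding Es(2)[symmetric] computation_space_def by simp
  qed
  obtain Ds where Ds: "Cs = input_config M u # Ds"
    using len comp' by (cases Cs) (auto simp: computation_def)
  show ?thesis
    using that[of Ds] \<open>run Cs\<close> ge le unfolding Ds by blast
qed

end

locale total_machine = machine M for M :: "('a, 'q) tm" +
  assumes total: "\<forall>u\<in>lists (input_alphabet M). accepts M u \<or> rejects M u"
begin

text \<open>
  Each overflow shows that the cells are fewer than the space of the input, and the next attempt
  has one cell more. The attempt that succeeds has held all configurations of the run.
\<close>

lemma run_from_restart: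
  assumes "cs \<in> lists cells" "length cs + 4 \<le> B" "word_space M (rev (input cs)) + 4 \<le> B"
  shows "\<exists>cs'. cs' \<in> lists cells \<and> word_space M (rev (input cs)) \<le> 2 * k * length cs' \<and>
    reaches B (left_word Restart (map reset_cell cs)) (left_word Halt cs')"
  using assms
proof (induction "word_space M (rev (input cs)) - length cs" arbitrary: cs rule: less_induct)
  case less
  define u where "u = rev (input cs)"
  note input = represents_input[OF less.prems(1), folded u_def]
  obtain Cs where Cs: "run (input_config M u # Cs)"
    "\<And>D. D \<in> set (input_config M u # Cs) \<Longrightarrow> config_space D \<le> word_space M u"
    "\<exists>D\<in>set (input_config M u # Cs). word_space M u \<le> config_space D"
    using obtain_run total input(1) by blast
  let ?start = "left_word (Push (\<lambda>_. []) (start_states M)) (map reset_cell cs)"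
  have "reaches B ([] @ [LMark, Head Restart] @ map RCell (map reset_cell cs) @ [RMark])
    ([] @ [LMark, Head (Push (\<lambda>_. []) (start_states M))] @ map RCell (map reset_cell cs) @ [RMark])"
    using less.prems(2) by (intro reaches_step rules.start) auto
  then have start: "reaches B (left_word Restart (map reset_cell cs)) ?start" by simp
  have "length (map reset_cell cs) + 4 \<le> B" using less.prems(2) by simp
  from simulate_run[OF Cs(1) is_config_input[OF input(1)] input(2) this]
  show ?case
  proof (elim disjE exE conjE)
    fix ds assume ds: "ds \<in> lists cells" "length ds = length (map reset_cell cs)"
      "input ds = input (map reset_cell cs)"
      and "\<exists>D\<in>set (input_config M u # Cs). length (map reset_cell cs) < config_space D"
      and over: "reaches B ?start (overflow_word ds)"
    then have room: "length cs < word_space M u" using Cs(2) by fastforce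
    have inp: "input ds = input cs"
      unfolding ds(3) by (induction cs) (auto simp: reset_cell_def)
    define cs' where "cs' = ds @ [blank_cell]"
    have cs': "cs' \<in> lists cells" "length cs' = Suc (length cs)" "input cs' = input cs"
      using ds inp blank_closed by (auto simp: cs'_def) (auto simp: blank_cell_def)
    have "reaches B ([LMark] @ map LCell ds @ Head Restart # [RCell blank_cell, RMark])
        ([LMark] @ Head Restart # map RCell (map reset_cell ds) @ [RCell blank_cell, RMark])"
      using less.prems(3) room ds(1,2) by (intro restart_sweep) (auto simp: u_def)
    then have again: "reaches B (overflow_word ds) (left_word Restart (map reset_cell cs'))"
      by (simp add: cs'_def reset_blank)
    have "\<exists>ds'. ds' \<in> lists cells \<and> word_space M (rev (input cs')) \<le> 2 * k * length ds' \<and>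
        reaches B (left_word Restart (map reset_cell cs')) (left_word Halt ds')"
      using less.prems(3) room cs' by (intro less.hyps) (auto simp: u_def)
    then obtain ds' where "ds' \<in> lists cells" "word_space M (rev (input cs)) \<le> 2 * k * length ds'"
      "reaches B (left_word Restart (map reset_cell cs')) (left_word Halt ds')"
      unfolding cs'(3) by blast
    then show ?thesis
      using reaches_trans[OF start reaches_trans[OF over reaches_trans[OF again]]] by blast
  next
    fix ds assume ds: "ds \<in> lists cells" "length ds = length (map reset_cell cs)"
      "\<forall>D\<in>set (input_config M u # Cs). config_space D \<le> 2 * k * length ds"
      "reaches B ?start (left_word Halt ds)"
    then have "word_space M u \<le> 2 * k * length ds" using Cs(3) order_trans by blast
    then show ?thesis using ds start unfolding u_def by (blast intro: reaches_trans)
  qed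
qed

lemma terminal: "\<not> rstep rules [LMark, Head Halt, RMark] w"
proof
  have u: "uncut ([LMark] @ Head Halt # [RMark] :: ('a cell, ('a, 'q) head) letter list)" by simp
  assume "rstep rules [LMark, Head Halt, RMark] w"
  then show False
  proof (cases rule: rstep_cases)
    case (right x s z y r)
    then have "[LMark] = x \<and> Halt = s \<and> [RMark] = z # y"
      using uncut_unique_head[OF u, of x s "z # y"] right(2) by simp
    then have "([Head Halt, RMark], r) \<in> rules" using right(4) by simp
    then show ?thesis by cases
  next
    case (left x s z y r)
    then have "Halt = s"
      using uncut_unique_head[OF u, of "x @ [z]" s y] left(2) by simp
    then show ?thesis using left(1) by auto
  qed
qed

lemma halt_reaches:
  assumes "cs \<in> lists cells" "length cs + 3 \<le> B"
  shows "reaches B (left_word Halt cs) [LMark, Head Halt, RMark]"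
  using erase_sweep[of "[LMark]" cs "[RMark]" B] assms by simp

text \<open>
  The path to the terminal word stays within \<open>B\<close>, and the orbit is nothing but this path.
\<close>

lemma restart_orbit_bounded:
  assumes "cs \<in> lists cells" "length cs + 4 \<le> B" "word_space M (rev (input cs)) + 4 \<le> B"
  shows "orbit_bounded B (left_word Restart (map reset_cell cs))"
proof -
  let ?w = "left_word Restart (map reset_cell cs)"
  obtain cs' where cs': "cs' \<in> lists cells" "reaches B ?w (left_word Halt cs')"
    using run_from_restart[OF assms] by blast
  then have "length (left_word Halt cs' :: ('a cell, ('a, 'q) head) letter list) \<le> B"
    unfolding reaches_def by (auto elim: rtranclp.cases)
  then have "reaches B (left_word Halt cs') [LMark, Head Halt, RMark]"
    using halt_reaches[OF cs'(1)] by simp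
  with cs'(2) have "reaches B ?w [LMark, Head Halt, RMark]" by (rule reaches_trans)
  moreover have "orbit_bounded B [LMark, Head Halt, RMark]"
    by (rule orbit_boundedI) (use assms(2) terminal in simp_all)
  moreover have "uncut ?w"
    using linked_cells(6)[of Restart "map reset_cell cs"]
    by (simp only: successively.simps linked.simps simp_thms)
  ultimately show ?thesis using reaches_orbit_bounded by blast
qed

text \<open>
  Whatever the cells left of a restarting head contain, the restart sweep forgets all of it
  except the input entries. It gets stuck if the left mark is missing.
\<close>

lemma restart_anywhere_orbit_bounded:
  assumes "uncut (x @ Head Restart # map RCell (map reset_cell cs) @ [RMark])"
    and "cs \<in> lists cells" "length x + length cs \<le> n" "n + 4 \<le> B"
    and f: "\<And>u. u \<in> lists (input_alphabet M) \<Longrightarrow> length u \<le> n \<Longrightarrow> word_space M u + 4 \<le> B"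
  shows "orbit_bounded B (x @ Head Restart # map RCell (map reset_cell cs) @ [RMark])"
  using assms(1-3)
proof (induction x arbitrary: cs rule: rev_induct)
  case Nil
  let ?w = "[] @ Head Restart # map RCell (map reset_cell cs) @ [RMark]"
  show ?case
  proof (rule orbit_boundedI)
    show "length ?w \<le> B" using Nil assms(4) by simp
    fix w' assume "rstep rules ?w w'"
    then show "orbit_bounded B w'"
    proof (cases rule: rstep_cases)
      case (right x s z y r)
      then have "s = Restart"
        using uncut_unique_head[OF Nil.prems(1), of x s "z # y"] by simp
      then show ?thesis using right(1) by simp
    next
      case (left x s z y r)
      then show ?thesis
        using uncut_unique_head[OF Nil.prems(1), of "x @ [z]" s y] by simp
    qed
  qed
next
  case (snoc a x)
  let ?w = "(x @ [a]) @ Head Restart # map RCell (map reset_cell cs) @ [RMark]"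
  show ?case
  proof (rule orbit_boundedI)
    show "length ?w \<le> B" using snoc.prems assms(4) by simp
    fix w' assume step: "rstep rules ?w w'"
    then show "orbit_bounded B w'"
    proof (cases rule: rstep_cases)
      case (right y s z v r)
      then have "s = Restart"
        using uncut_unique_head[OF snoc.prems(1), of y s "z # v"] by simp
      then show ?thesis using right(1) by simp
    next
      case (left y s z v r)
      then have eq: "x = y" "a = z" "s = Restart" "v = map RCell (map reset_cell cs) @ [RMark]"
        using uncut_unique_head[OF snoc.prems(1), of "y @ [z]" s v] by simp_all
      from left(4) show ?thesis
      proof cases
        case (reset c)
        have "w' = x @ Head Restart # map RCell (map reset_cell (c # cs)) @ [RMark]"
          using reset left(3) eq by simp
        moreover have "uncut w'"
          using rsteps_uncut[OF r_into_rtranclp[of "rstep rules", OF step] snoc.prems(1)] .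
        ultimately show ?thesis
          using snoc.IH[of "c # cs"] snoc.prems(2,3) reset by simp
      next
        case start
        have "\<not> linked z' LMark" for z' :: "('a cell, ('a, 'q) head) letter"
          by (cases z') auto
        then have "x = []"
          using snoc.prems(1) eq start by (auto simp: successively_append_iff)
        then have w: "?w = left_word Restart (map reset_cell cs)" using eq start by simp
        have "length (rev (input cs)) \<le> n"
          using snoc.prems(3) length_input[of cs] by simp
        then have "orbit_bounded B (left_word Restart (map reset_cell cs))"
          using snoc.prems(2,3) assms(4) f[OF represents_input(1)]
          by (intro restart_orbit_bounded) auto
        then have "orbit_bounded B ?w" unfolding w .
        then show ?thesis using step by (rule orbit_bounded_step)
      qed (use eq in auto)
    qed
  qed
qed

text \<open>
  Until its first overflow a block does not grow. From then on its head computes with the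
  input that is left in the cells, whatever the block was before, or is stuck.
\<close>

lemma uncut_orbit_bounded:
  assumes "uncut w" "length w \<le> n" "n + 4 \<le> B"
    and f: "\<And>u. u \<in> lists (input_alphabet M) \<Longrightarrow> length u \<le> n \<Longrightarrow> word_space M u + 4 \<le> B"
  shows "orbit_bounded B w"
proof -
  have "(uncut z \<and> length z \<le> n) \<or> orbit_bounded B z" if "(rstep rules)\<^sup>*\<^sup>* w z" for z
    using that
  proof (induction rule: rtranclp_induct)
    case base
    then show ?case using assms by simp
  next
    case (step y z)
    show ?case
    proof (cases "orbit_bounded B y")
      case True
      then show ?thesis using step.hyps(2) orbit_bounded_step by blast
    next
      case False
      then have y: "uncut y" "length y \<le> n" using step.IH by auto
      have z: "uncut z" using rsteps_uncut[OF r_into_rtranclp[of "rstep rules", OF step.hyps(2)] y(1)] .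
      from step.hyps(2) obtain u v l r where lr: "(l, r) \<in> rules" "y = u @ l @ v" "z = u @ r @ v"
        unfolding rstep_def by blast
      from lr(1) show ?thesis
      proof cases
        case (overflow b qs)
        have "uncut (u @ Head (Push b qs) # RMark # v)" using y(1) lr(2) overflow by simp
        then have "v = []"
          using uncut_around_head(2)[of u "Push b qs" "RMark # v"]
          by (auto simp: Cons_eq_map_conv Cons_eq_append_conv)
        then have "z = u @ Head Restart # map RCell (map reset_cell [blank_cell]) @ [RMark]"
          using lr(3) overflow by (simp add: reset_blank)
        moreover have "length u + 1 \<le> n" using y(2) lr(2) overflow by simp
        ultimately have "orbit_bounded B z"
          using z restart_anywhere_orbit_bounded[of u "[blank_cell]" n B] assms(3) f blank_closed
          by simp
        then show ?thesis by simp
      qed (use y(2) z lr(2,3) in auto)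
    qed
  qed
  then have "length z \<le> B" if "(rstep rules)\<^sup>*\<^sup>* w z" for z
    using that orbit_bounded_length[of B z] assms(3) by fastforce
  then show ?thesis by (simp add: orbit_bounded_def)
qed

end

section \<open>Comparison of the space functions\<close>

lemma Sup_nat_le: "(\<And>x. x \<in> S \<Longrightarrow> x \<le> c) \<Longrightarrow> Sup S \<le> c" for S :: "nat set"
  by (cases "S = {}") (auto intro: cSup_least)

lemma le_Sup_nat: "(\<And>x. x \<in> S \<Longrightarrow> x \<le> c) \<Longrightarrow> x \<in> S \<Longrightarrow> x \<le> Sup S" for S :: "nat set"
  by (auto intro!: cSup_upper bdd_aboveI)

text \<open>
  The space function with respect to a given set of words, of which those of semigroups and
  monoids are instances.
\<close>

definition space_on :: "('b list \<times> 'b list) set \<Rightarrow> 'b list set \<Rightarrow> nat \<Rightarrow> nat" where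
  "space_on R W n = Sup {pair_space R w w' | w w'. w \<in> W \<and> w' \<in> W \<and>
     length w \<le> n \<and> length w' \<le> n \<and> equal_in R w w'}"

lemma space_on_rename:
  assumes "\<And>w w'. w \<in> W \<Longrightarrow> w' \<in> W \<Longrightarrow>
     equal_in R' (map g w) (map g w') = equal_in R w w' \<and>
     pair_space R' (map g w) (map g w') = pair_space R w w'"
  shows "space_on R' (map g ` W) = space_on R W"
proof
  fix n
  have "{pair_space R' w w' | w w'. w \<in> map g ` W \<and> w' \<in> map g ` W \<and>
      length w \<le> n \<and> length w' \<le> n \<and> equal_in R' w w'} =
    {pair_space R' (map g w) (map g w') | w w'. w \<in> W \<and> w' \<in> W \<and>
      length w \<le> n \<and> length w' \<le> n \<and> equal_in R' (map g w) (map g w')}"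
    by (auto; metis length_map imageI)
  also have "\<dots> = {pair_space R w w' | w w'. w \<in> W \<and> w' \<in> W \<and>
      length w \<le> n \<and> length w' \<le> n \<and> equal_in R w w'}"
    using assms by (intro Collect_cong ex_cong1) metis
  finally show "space_on R' (map g ` W) n = space_on R W n" by (simp add: space_on_def)
qed

context total_machine
begin

lemma word_space_le_space_complexity:
  assumes "u \<in> lists (input_alphabet M)" "length u \<le> n"
  shows "word_space M u \<le> space_complexity M n"
proof -
  have "finite {u. set u \<subseteq> input_alphabet M \<and> length u \<le> n}"
    by (intro finite_lists_length_le finite_alphabets)
  then have "finite (word_space M ` {u. set u \<subseteq> input_alphabet M \<and> length u \<le> n})" by simp
  moreover have "{word_space M u | u. u \<in> lists (input_alphabet M) \<and> length u \<le> n} =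
      word_space M ` {u. set u \<subseteq> input_alphabet M \<and> length u \<le> n}"
    by (auto simp: in_lists_conv_set)
  ultimately have "bdd_above {word_space M u | u. u \<in> lists (input_alphabet M) \<and> length u \<le> n}"
    by (simp add: bdd_above_finite)
  then show ?thesis
    unfolding space_complexity_def using assms by (intro cSup_upper) auto
qed

lemma space_complexity_mono: "m \<le> n \<Longrightarrow> space_complexity M m \<le> space_complexity M n"
  unfolding space_complexity_def[of M m]
  by (rule Sup_nat_le) (auto intro: word_space_le_space_complexity)

lemma pair_space_upper:
  assumes "equal_in rules w w'" "length w \<le> n" "length w' \<le> n"
  shows "pair_space rules w w' \<le> space_complexity M n + 3 * n + 4"
proof -
  let ?B = "space_complexity M n + n + 4"
  have "orbit_bounded ?B z" if "uncut z" "length z \<le> n" for z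
    using that
  proof (rule uncut_orbit_bounded)
    fix u assume "u \<in> lists (input_alphabet M)" "length u \<le> n"
    then have "word_space M u \<le> space_complexity M n" by (rule word_space_le_space_complexity)
    then show "word_space M u + 4 \<le> ?B" by simp
  qed simp
  then have "joined rules (length w + length w' + ?B) w w'"
    using assms by (rule joined_if_orbits_bounded)
  then have "pair_space rules w w' \<le> length w + length w' + ?B" by (rule pair_space_le)
  then show ?thesis using assms by simp
qed

definition input_word :: "'a list \<Rightarrow> ('a cell, ('a, 'q) head) letter list" where
  "input_word u =
     LMark # map LCell (map (\<lambda>a. (Some a, \<lambda>_. None)) (rev u)) @ [Head Restart, RMark]"

text \<open>
  The forward path from the word of an input passes a word whose cells have held all
  configurations of the run and are about to be deleted. No derivation can avoid this word.
\<close>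

lemma input_word_derivation:
  assumes "u \<in> lists (input_alphabet M)"
  defines "final \<equiv> [LMark, Head Halt, RMark]"
  shows "equal_in rules (input_word u) final"
    and "word_space M u \<le> 2 * k * pair_space rules (input_word u) final"
proof -
  define cs :: "'a cell list" where "cs = map (\<lambda>a. (Some a, \<lambda>_. None)) (rev u)"
  have cs: "cs \<in> lists cells"
    using assms(1) by (auto simp: cs_def cells_def in_lists_conv_set)
  have "concat (map (\<lambda>a. [a]) xs) = xs" for xs :: "'a list" by (induction xs) auto
  then have input: "rev (input cs) = u"
    by (simp add: cs_def input_def comp_def)
  define B where "B = length cs + word_space M u + 4"
  have "reaches B ([LMark] @ map LCell cs @ Head Restart # [RMark])
      ([LMark] @ Head Restart # map RCell (map reset_cell cs) @ [RMark])"
    using cs by (intro restart_sweep) (simp_all add: B_def)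
  then have 1: "reaches B (input_word u) (left_word Restart (map reset_cell cs))"
    by (simp add: input_word_def cs_def)
  obtain cs' where cs': "cs' \<in> lists cells" "word_space M u \<le> 2 * k * length cs'"
      "reaches B (left_word Restart (map reset_cell cs)) (left_word Halt cs')"
    using run_from_restart[OF cs, of B] by (auto simp: input B_def)
  let ?z = "left_word Halt cs' :: ('a cell, ('a, 'q) head) letter list"
  have to_z: "(rstep rules)\<^sup>*\<^sup>* (input_word u) ?z"
    by (rule reaches_rsteps[OF reaches_trans[OF 1 cs'(3)]])
  have from_z: "(rstep rules)\<^sup>*\<^sup>* ?z final"
    unfolding final_def by (rule reaches_rsteps[OF halt_reaches[OF cs'(1) order_refl]])
  have "(rstep rules)\<^sup>*\<^sup>* (input_word u) final" using to_z from_z by (rule rtranclp_trans)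
  moreover have "rstep rules \<le> rewrite_step rules"
    by (auto simp: rewrite_step_iff_rstep)
  ultimately show eq: "equal_in rules (input_word u) final"
    unfolding equal_in_iff_rtranclp using rtranclp_mono by blast
  have "uncut (input_word u)"
  proof -
    define xs :: "('a cell, ('a, 'q) head) letter list" where "xs = map LCell cs @ [Head Restart]"
    have "uncut xs" unfolding xs_def by simp
    moreover have "linked LMark (hd xs)" unfolding xs_def by (cases cs) simp_all
    moreover have "last xs = Head Restart" "xs \<noteq> []" by (simp_all add: xs_def)
    ultimately have "uncut (LMark # xs @ [RMark])"
      by (simp add: successively_Cons successively_append_iff hd_append)
    then show ?thesis by (simp add: input_word_def cs_def xs_def)
  qed
  then have "length ?z \<le> pair_space rules (input_word u) final"
    using joined_through_path[OF joined_pair_space[OF eq] _ to_z from_z] terminal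
    by (simp add: final_def)
  then have "length cs' \<le> pair_space rules (input_word u) final" by simp
  then show "word_space M u \<le> 2 * k * pair_space rules (input_word u) final"
    using cs'(2) by (meson le_trans mult_le_mono2)
qed

definition alphabet :: "('a cell, ('a, 'q) head) letter set" where
  "alphabet = (\<Union>(l, r)\<in>rules. set l \<union> set r) \<union> LCell ` cells \<union>
     {LMark, RMark, Head Restart, Head Halt}"

lemma finite_alphabet: "finite alphabet"
  using finite_rules finite_cells by (auto simp: alphabet_def)

lemma rules_alphabet: "rules \<subseteq> semigroup_words alphabet \<times> semigroup_words alphabet"
proof
  fix p assume p: "p \<in> rules"
  obtain l r where lr: "p = (l, r)" by fastforce
  have "set l \<subseteq> alphabet" "set r \<subseteq> alphabet" using p lr by (auto simp: alphabet_def)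
  moreover have "l \<noteq> []" "r \<noteq> []" using rule_sides(1,2) p lr by auto
  ultimately show "p \<in> semigroup_words alphabet \<times> semigroup_words alphabet"
    using lr by (auto simp: semigroup_words_def in_lists_conv_set)
qed

theorem space_on_equiv:
  assumes W: "semigroup_words alphabet \<subseteq> W" "W \<subseteq> lists alphabet"
  shows "fun_equiv (space_complexity M) (space_on rules W)"
proof -
  \<comment> \<open>The linear term \<open>3 * n + 4\<close> is at most \<open>7 * n\<close>.\<close>
  have "space_on rules W n \<le> 7 * space_complexity M (7 * n) + 7 * n" if "n \<ge> 1" for n
  proof -
    have "space_on rules W n \<le> space_complexity M n + 3 * n + 4"
      unfolding space_on_def by (rule Sup_nat_le) (auto intro: pair_space_upper)
    moreover have "space_complexity M n \<le> space_complexity M (7 * n)"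
      by (rule space_complexity_mono) simp
    ultimately show ?thesis using that by linarith
  qed
  then have "fun_preceq (space_on rules W) (space_complexity M)"
    unfolding fun_preceq_def by (intro exI[of _ 7]) simp
  moreover
  \<comment> \<open>A cell has room for \<open>2 * k\<close> letters of stacks, and the word of an input of length at most \<open>n\<close>
    has at most \<open>n + 3 \<le> 4 * n\<close> letters.\<close>
  let ?c = "2 * k + 4"
  have "space_complexity M n \<le> ?c * space_on rules W (?c * n) + ?c * n" if "n \<ge> 1" for n
  proof -
    have "word_space M u \<le> ?c * space_on rules W (?c * n) + ?c * n"
      if u: "u \<in> lists (input_alphabet M)" "length u \<le> n" for u
    proof -
      let ?f = "[LMark, Head Halt, RMark] :: ('a cell, ('a, 'q) head) letter list"
      have "input_word u \<in> semigroup_words alphabet"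
        using u by (auto simp: semigroup_words_def input_word_def alphabet_def cells_def)
      moreover have "?f \<in> semigroup_words alphabet"
        by (auto simp: semigroup_words_def alphabet_def)
      moreover have "length (input_word u) \<le> ?c * n" "length ?f \<le> ?c * n"
        using u(2) \<open>n \<ge> 1\<close> by (auto simp: input_word_def algebra_simps)
      ultimately have "pair_space rules (input_word u) ?f \<le> space_on rules W (?c * n)"
        unfolding space_on_def using W input_word_derivation(1)[OF u(1)]
        by (intro le_Sup_nat[where c = "space_complexity M (?c * n) + 3 * (?c * n) + 4"])
          (use pair_space_upper in blast)+
      then have "2 * k * pair_space rules (input_word u) ?f \<le> ?c * space_on rules W (?c * n)"
        by (intro mult_le_mono) auto
      then show ?thesis using input_word_derivation(2)[OF u(1)] by linarith
    qed
    then show ?thesis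
      unfolding space_complexity_def[of M n] by (intro Sup_nat_le) auto
  qed
  then have "fun_preceq (space_complexity M) (space_on rules W)"
    unfolding fun_preceq_def by (intro exI[of _ ?c]) simp
  ultimately show ?thesis by (simp add: fun_equiv_def)
qed

end

theorem corollary1p4:
  fixes M :: "('a, 'q) tm"
  assumes "turing_machine M" and "deterministic M"
    and "\<forall>u\<in>lists (input_alphabet M). accepts M u \<or> rejects M u"
  shows "(\<exists>(A :: nat set) R. finite_semigroup_presentation A R \<and>
            fun_equiv (space_complexity M) (semigroup_space_function A R)) \<and>
         (\<exists>(A :: nat set) R. finite_monoid_presentation A R \<and>
            fun_equiv (space_complexity M) (monoid_space_function A R))"
proof -
  interpret total_machine M
    using assms by unfold_locales
  let ?A = alphabet
  have "rules \<subseteq> lists ?A \<times> lists ?A"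
    using rules_alphabet by (auto simp: semigroup_words_def)
  then obtain g :: "('a cell, ('a, 'q) head) letter \<Rightarrow> nat" and R' where
    R': "R' = map_prod (map g) (map g) ` rules" and
    g: "\<And>w w'. w \<in> lists ?A \<Longrightarrow> w' \<in> lists ?A \<Longrightarrow>
       equal_in R' (map g w) (map g w') = equal_in rules w w' \<and>
       pair_space R' (map g w) (map g w') = pair_space rules w w'"
    using rename_presentation[OF finite_alphabet] by metis
  have words: "semigroup_words (g ` ?A) = map g ` semigroup_words ?A"
    by (auto simp: semigroup_words_def lists_image)
  have "finite_semigroup_presentation (g ` ?A) R'"
    using rules_alphabet finite_alphabet finite_rules
    unfolding finite_semigroup_presentation_def words R' by force
  moreover from this have "finite_monoid_presentation (g ` ?A) R'"
    by (auto simp: finite_semigroup_presentation_def finite_monoid_presentation_def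
      semigroup_words_def)
  moreover have "semigroup_space_function (g ` ?A) R' = space_on rules (semigroup_words ?A)"
  proof -
    have "semigroup_space_function (g ` ?A) R' = space_on R' (map g ` semigroup_words ?A)"
      unfolding words[symmetric] by (rule ext) (simp add: semigroup_space_function_def space_on_def)
    also have "\<dots> = space_on rules (semigroup_words ?A)"
      using g by (intro space_on_rename) (auto simp: semigroup_words_def)
    finally show ?thesis .
  qed
  moreover have "monoid_space_function (g ` ?A) R' = space_on rules (lists ?A)"
  proof -
    have "monoid_space_function (g ` ?A) R' = space_on R' (map g ` lists ?A)"
      unfolding lists_image[symmetric] by (rule ext) (simp add: monoid_space_function_def space_on_def)
    also have "\<dots> = space_on rules (lists ?A)"
      using g by (intro space_on_rename)
    finally show ?thesis .
  qed
  moreover have "fun_equiv (space_complexity M) (space_on rules (semigroup_words ?A))"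
    "fun_equiv (space_complexity M) (space_on rules (lists ?A))"
    by (intro space_on_equiv; auto simp: semigroup_words_def)+
  ultimately show ?thesis by metis
qed

end
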